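(* Let $k$ be an arbitrary field and $R=k[x,y]$. Let $H=(H_0,H_1,\dots)$ be a sequence of the form $H=(1,2,\ldots,\mu,H_\mu,H_{\mu+1},\ldots)$ with $\mu\ge1$, $\mu\ge H_\mu\ge H_{\mu+1}\ge\cdots$ and $\lim_{i\to\infty}H_i=0$. Put $e_i=H_{i-1}-H_i$ for $i\ge\mu$ and $e_i=0$ for $i<\mu$. Let $\mathrm{ST}=(\mathrm{ST}_0,\mathrm{ST}_1,\dots)$ be a sequence of nonnegative integers. Then there is a graded Artinian quotient $A=R/I$ of $R$ with Hilbert function $H(A)=H$ and socle type $\mathrm{ST}$ if and only if for all $i\ge 0$ $$e_{i+1}-e_{i+2}\ \le\ \mathrm{ST}_i\ \le\ e_{i+1}.$$
   Context: $R=k[x,y]$ has the standard grading and $I$ is a graded ideal. The Hilbert function is $H(A)_i=\dim_kA_i$. With $M=(x,y)$, the socle of $A$ is $\mathrm{Soc}(A)=(0:M)\subset A$, and the socle type of $A$ is the Hilbert function of the socle: $\mathrm{ST}_i=\dim_k\mathrm{Soc}(A)_i$. *)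

theory Defs
  imports
    "HOL-Library.Poly_Mapping"
    "HOL-Library.Product_Plus"
    "HOL-Algebra.Embedded_Algebras"
    "HOL-Algebra.QuotRing"
    "HOL-Algebra.Algebraic_Closure_Type"
begin

text \<open>
  The ring $k[x,y]$ is the monoid algebra of $\mathbb{N}^2$: the finitely supported function
  \<open>f\<close> stands for the sum of all \<open>lookup f (a, b) x^a y^b\<close>, and the type-class multiplication
  of \<^typ>\<open>(nat \<times> nat) \<Rightarrow>\<^sub>0 'k\<close> is convolution.
\<close>

type_synonym 'k poly2 = "(nat \<times> nat) \<Rightarrow>\<^sub>0 'k"

abbreviation poly2_ring :: "'k::field poly2 ring" where
  "poly2_ring \<equiv> ring_of_type_algebra"

definition const2 :: "'k::field \<Rightarrow> 'k poly2" where
  "const2 c = Poly_Mapping.single (0, 0) c"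

definition var_x :: "'k::field poly2" where
  "var_x = Poly_Mapping.single (1, 0) 1"

definition var_y :: "'k::field poly2" where
  "var_y = Poly_Mapping.single (0, 1) 1"

definition total_deg :: "nat \<times> nat \<Rightarrow> nat" where
  "total_deg m = fst m + snd m"

definition forms :: "nat \<Rightarrow> 'k::field poly2 set" where
  "forms i = {f. \<forall>m \<in> Poly_Mapping.keys f. total_deg m = i}"

definition hom_component :: "nat \<Rightarrow> 'k::field poly2 \<Rightarrow> 'k poly2" where
  "hom_component i f =
     (\<Sum>m \<in> {m \<in> Poly_Mapping.keys f. total_deg m = i}. Poly_Mapping.single m (Poly_Mapping.lookup f m))"

definition graded_ideal :: "'k::field poly2 set \<Rightarrow> bool" where
  "graded_ideal I \<longleftrightarrow> ideal I poly2_ring \<and> (\<forall>f \<in> I. \<forall>i. hom_component i f \<in> I)"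

definition max_ideal :: "'k::field poly2 set" where
  "max_ideal = Idl\<^bsub>poly2_ring\<^esub> {var_x, var_y}"

abbreviation quot :: "'k::field poly2 set \<Rightarrow> 'k poly2 set ring" where
  "quot I \<equiv> poly2_ring Quot I"

definition residue_class :: "'k::field poly2 set \<Rightarrow> 'k poly2 \<Rightarrow> 'k poly2 set" where
  "residue_class I f = I +>\<^bsub>poly2_ring\<^esub> f"

text \<open>
  The field $k$ acts on $A = R/I$ through its image in \<open>A\<close>, which is a subfield when
  \<open>I\<close> is proper. Dimensions over $k$ are therefore dimensions over this subfield, in the sense of
  \<^const>\<open>ring.dimension\<close>.
\<close>

definition scalars :: "'k::field poly2 set \<Rightarrow> 'k poly2 set set" where
  "scalars I = residue_class I ` range const2"

definition quot_graded :: "'k::field poly2 set \<Rightarrow> nat \<Rightarrow> 'k poly2 set set" where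
  "quot_graded I i = residue_class I ` forms i"

definition has_hilbert_function :: "'k::field poly2 set \<Rightarrow> (nat \<Rightarrow> nat) \<Rightarrow> bool" where
  "has_hilbert_function I H \<longleftrightarrow>
     (\<forall>i. ring.dimension (quot I) (H i) (scalars I) (quot_graded I i))"

definition socle :: "'k::field poly2 set \<Rightarrow> 'k poly2 set set" where
  "socle I = {a \<in> carrier (quot I).
     \<forall>m \<in> max_ideal. residue_class I m \<otimes>\<^bsub>quot I\<^esub> a = \<zero>\<^bsub>quot I\<^esub>}"

definition has_socle_type :: "'k::field poly2 set \<Rightarrow> (nat \<Rightarrow> nat) \<Rightarrow> bool" where
  "has_socle_type I ST \<longleftrightarrow>
     (\<forall>i. ring.dimension (quot I) (ST i) (scalars I) (socle I \<inter> quot_graded I i))"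

text \<open>Descending chain condition on (two-sided) ideals; only used for commutative rings.\<close>

definition artinian :: "('a, 'b) ring_scheme \<Rightarrow> bool" where
  "artinian A \<longleftrightarrow>
     (\<forall>J :: nat \<Rightarrow> 'a set. (\<forall>n. ideal (J n) A \<and> J (Suc n) \<subseteq> J n) \<longrightarrow>
        (\<exists>N. \<forall>n \<ge> N. J n = J N))"

definition first_diff :: "nat \<Rightarrow> (nat \<Rightarrow> nat) \<Rightarrow> nat \<Rightarrow> int" where
  "first_diff \<mu> H i = (if i < \<mu> then 0 else int (H (i - 1)) - int (H i))"

end

theory Submission
  imports Defs
begin

text \<open>
  Ordering the monomials of a fixed degree by their \<open>x\<close>-exponent, the dimension of a space of
  forms is the number of its leading exponents. Let \<open>S\<close> be the space of forms of degree \<open>i\<close>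
  carried into \<open>I\<close> by both variables. The leading exponents of \<open>I\<^sub>i\<^sub>+\<^sub>1\<close> contain those of
  \<open>S\<close> and their successors, so \<open>dim I\<^sub>i\<^sub>+\<^sub>1 > dim S\<close> unless \<open>S = 0\<close>; this is the upper bound.
  The lower bound is the modular law for \<open>x I\<^sub>i\<^sub>+\<^sub>1\<close> and \<open>y I\<^sub>i\<^sub>+\<^sub>1\<close> inside \<open>I\<^sub>i\<^sub>+\<^sub>2\<close>,
  whose intersection is \<open>xy S\<close>.

  Conversely, a monomial ideal with \<open>\<mu>\<close> nonempty rows is given by the degrees \<open>d b\<close> of the first
  monomial \<open>x^a y^b\<close> of the ideal in row \<open>b < \<mu>\<close>, where \<open>b < d b\<close> and \<open>d (b + 1) \<le> d b + 1\<close>. If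
  every \<open>d b \<ge> \<mu>\<close>, the Hilbert function is \<open>H\<close> as soon as each value \<open>j\<close> is taken \<open>e\<^sub>j\<close> times,
  and the socle in degree \<open>i\<close> counts the \<open>b\<close> with \<open>d b = i + 1\<close> that are not followed by an ascent
  to \<open>i + 2\<close>. The word \<open>d\<close> must thus have \<open>r\<^sub>j = e\<^sub>j - ST\<^sub>j\<^sub>-\<^sub>1\<close> ascents from \<open>j\<close> to \<open>j + 1\<close>, and the
  hypothesis says precisely that \<open>0 \<le> r\<^sub>j \<le> min e\<^sub>j e\<^sub>j\<^sub>+\<^sub>1\<close>. Such a word is built by adding the
  letters in increasing order: put \<open>j + 1\<close> behind the first \<open>r\<^sub>j\<close> occurrences of \<open>j\<close> and all remaining
  copies of \<open>j + 1\<close> at the front.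
\<close>

subsection \<open>Leading exponents\<close>

declare split_paired_All [simp del] split_paired_Ex [simp del]

text \<open>For a set \<open>S\<close> of monomials this is the space they span. The forms of one
  degree and the monomial ideals both have this shape.\<close>

definition supported :: "'a set \<Rightarrow> ('a \<Rightarrow>\<^sub>0 'k::zero) set" where
  "supported S = {f. \<forall>m. Poly_Mapping.lookup f m \<noteq> 0 \<longrightarrow> m \<in> S}"

text \<open>The weight \<open>w\<close> stands in for a monomial order: where it is injective on the
  monomials in play, a largest weight singles out a leading monomial. For a subspace with finite
  support, the number of leading weights is then the dimension. Two kinds of weight occur:
  \<open>fst\<close> on forms of one degree, and an arbitrary injection on a finite set of
  monomials.\<close>

definition leads :: "('a \<Rightarrow> nat) \<Rightarrow> ('a \<Rightarrow>\<^sub>0 'k::zero) set \<Rightarrow> nat set" where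
  "leads w V = {n. \<exists>f \<in> V. \<exists>m. Poly_Mapping.lookup f m \<noteq> 0 \<and> w m = n \<and> (\<forall>m'. Poly_Mapping.lookup f m' \<noteq> 0 \<longrightarrow> w m' \<le> n)}"

text \<open>These sets filter \<open>V\<close> by leading weight, so that induction on
  \<open>n\<close> is Gaussian elimination, one weight at a time.\<close>

definition truncation :: "('a \<Rightarrow> nat) \<Rightarrow> nat \<Rightarrow> ('a \<Rightarrow>\<^sub>0 'k::zero) set \<Rightarrow> ('a \<Rightarrow>\<^sub>0 'k) set" where
  "truncation w n V = {f \<in> V. \<forall>m. Poly_Mapping.lookup f m \<noteq> 0 \<longrightarrow> w m < n}"

lemma lookup_const2_mult [simp]:
  "Poly_Mapping.lookup (const2 c * f) m = c * Poly_Mapping.lookup f m"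
proof -
  have "const2 c * f = Poly_Mapping.map ((*) c) f"
    by (simp add: const2_def mult_map_scale_conv_mult flip: zero_prod_def)
  then show ?thesis
    by (simp add: Poly_Mapping.map.rep_eq when_def)
qed

interpretation poly2: vector_space "\<lambda>c (f :: 'k::field poly2). const2 c * f"
  by unfold_locales (auto intro!: poly_mapping_eqI simp: lookup_add distrib_left distrib_right mult.assoc)

lemma subspace_supported: "poly2.subspace (supported S)"
  by (rule poly2.subspaceI) (auto simp: supported_def lookup_add, metis add_0)

lemma leads_monic:
  assumes "poly2.subspace V" "n \<in> leads w V"
  obtains g m where "g \<in> V" "w m = n" "Poly_Mapping.lookup g m = 1"
    "\<forall>m'. Poly_Mapping.lookup g m' \<noteq> 0 \<longrightarrow> w m' \<le> n"
proof -
  obtain f m where f: "f \<in> V" "Poly_Mapping.lookup f m \<noteq> 0" "w m = n" "\<forall>m'. Poly_Mapping.lookup f m' \<noteq> 0 \<longrightarrow> w m' \<le> n"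
    using assms(2) by (auto simp: leads_def)
  let ?g = "const2 (inverse (Poly_Mapping.lookup f m)) * f"
  have "?g \<in> V"
    using assms(1) f(1) by (rule poly2.subspace_scale)
  moreover have "Poly_Mapping.lookup ?g m = 1"
    using f(2) by (simp add:)
  ultimately show thesis
    using f(3,4) by (intro that[of ?g m]) (auto )
qed

lemma leadsI:
  assumes "f \<in> V" "Poly_Mapping.lookup f m \<noteq> 0" "w m = n"
    "\<And>m'. Poly_Mapping.lookup f m' \<noteq> 0 \<Longrightarrow> w m' \<le> n"
  shows "n \<in> leads w V"
  using assms unfolding leads_def by (auto simp: intro!: bexI[of _ f] bexI[of _ m])

lemma leads_mono: "U \<subseteq> V \<Longrightarrow> leads w U \<subseteq> leads w V"
  unfolding leads_def by blast

lemma leads_supported: "V \<subseteq> supported S \<Longrightarrow> leads w V \<subseteq> w ` S"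
  unfolding leads_def supported_def by blast

lemma leads_supported_eq: "leads w (supported S :: ('a \<Rightarrow>\<^sub>0 'k::field) set) = w ` S"
proof
  show "w ` S \<subseteq> leads w (supported S :: ('a \<Rightarrow>\<^sub>0 'k) set)"
  proof
    fix n assume "n \<in> w ` S"
    then obtain m where "m \<in> S" "w m = n" by blast
    then show "n \<in> leads w (supported S :: ('a \<Rightarrow>\<^sub>0 'k) set)"
      by (intro leadsI[of "Poly_Mapping.single m 1" _ m])
         (auto simp: supported_def lookup_single when_def split: if_splits)
  qed
qed (simp add: leads_supported)

lemma truncation_Suc_no_lead:
  assumes "n \<notin> leads w V"
  shows "truncation w (Suc n) V = truncation w n V"
proof -
  have "w m < n" if f: "f \<in> V" "\<forall>m. Poly_Mapping.lookup f m \<noteq> 0 \<longrightarrow> w m < Suc n" "Poly_Mapping.lookup f m \<noteq> 0" for f m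
  proof (rule ccontr)
    assume "\<not> w m < n"
    with f have "w m = n" "\<And>m'. Poly_Mapping.lookup f m' \<noteq> 0 \<Longrightarrow> w m' \<le> n"
      using less_Suc_eq_le by (metis less_SucE, blast)
    with assms leadsI[OF f(1,3)] show False by blast
  qed
  then show ?thesis
    unfolding truncation_def by (auto simp: less_SucI)
qed

text \<open>By injectivity of \<open>w\<close>, the monomial \<open>m\<close> is the only one of
  weight \<open>n\<close> in \<open>S\<close>, so cancelling its coefficient lowers the leading
  weight.\<close>

lemma truncation_Suc_lead:
  assumes V: "poly2.subspace V" "V \<subseteq> supported S" "inj_on w S"
    and g: "g \<in> V" "w m = n" "Poly_Mapping.lookup g m = 1" "\<forall>m'. Poly_Mapping.lookup g m' \<noteq> 0 \<longrightarrow> w m' \<le> n"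
    and f: "f \<in> truncation w (Suc n) V"
  shows "f - const2 (Poly_Mapping.lookup f m) * g \<in> truncation w n V"
proof -
  let ?h = "f - const2 (Poly_Mapping.lookup f m) * g"
  have fV: "f \<in> V" and fn: "\<forall>m. Poly_Mapping.lookup f m \<noteq> 0 \<longrightarrow> w m \<le> n"
    using f by (auto simp: truncation_def)
  have h: "?h \<in> V"
    using V(1) fV g(1) by (intro poly2.subspace_diff poly2.subspace_scale)
  have "m \<in> S"
    using g(1,3) V(2) by (auto simp: supported_def)
  have "w m' < n" if m': "Poly_Mapping.lookup ?h m' \<noteq> 0" for m'
  proof -
    have "w m' \<le> n"
      using m' fn g(4) by (metis diff_self lookup_const2_mult lookup_minus mult_zero_right)
    moreover have "m' \<noteq> m"
      using m' g(3) by (auto simp: lookup_minus)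
    moreover have "m' \<in> S"
      using m' h V(2) by (auto simp: supported_def)
    ultimately show ?thesis
      using inj_onD[OF V(3), of m' m] \<open>m \<in> S\<close> g(2) by fastforce
  qed
  with h show ?thesis
    by (auto simp: truncation_def)
qed

text \<open>Reduction: the leading term of an element of \<open>V\<close> is cancelled by a monic
  element of \<open>U\<close>, again and again; each element has finite support, so the process ends
  at \<open>0\<close>.\<close>

lemma leads_subset_imp_subset:
  assumes U: "poly2.subspace U" "U \<subseteq> V" and V: "poly2.subspace V" "V \<subseteq> supported S" "inj_on w S"
    and leads: "leads w V \<subseteq> leads w U"
  shows "V \<subseteq> U"
proof -
  have trunc: "truncation w n V \<subseteq> U" for n
  proof (induction n)
    case 0
    have "f = 0" if "f \<in> truncation w 0 V" for f
      using that by (intro poly_mapping_eqI) (auto simp: truncation_def)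
    then show ?case
      using poly2.subspace_0[OF U(1)] by blast
  next
    case (Suc n)
    show ?case
    proof (cases "n \<in> leads w V")
      case False
      with Suc show ?thesis by (simp add: truncation_Suc_no_lead)
    next
      case True
      then obtain g m where g: "g \<in> U" "w m = n" "Poly_Mapping.lookup g m = 1"
        "\<forall>m'. Poly_Mapping.lookup g m' \<noteq> 0 \<longrightarrow> w m' \<le> n"
        using leads leads_monic[OF U(1)] by (metis subsetD)
      show ?thesis
      proof
        fix f assume f: "f \<in> truncation w (Suc n) V"
        have "f - const2 (Poly_Mapping.lookup f m) * g \<in> U"
          using truncation_Suc_lead[OF V _ g(2-4) f] g(1) U(2) Suc by blast
        from poly2.subspace_add[OF U(1) this poly2.subspace_scale[OF U(1) g(1), of "Poly_Mapping.lookup f m"]]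
        show "f \<in> U" by simp
      qed
    qed
  qed
  show ?thesis
  proof
    fix f assume f: "f \<in> V"
    obtain N where "\<forall>n \<in> w ` Poly_Mapping.keys f. n < N"
      using finite_nat_set_iff_bounded[of "w ` Poly_Mapping.keys f"] by auto
    with f have "f \<in> truncation w N V"
      by (auto simp: truncation_def in_keys_iff)
    with trunc show "f \<in> U" by blast
  qed
qed

section \<open>Adjoining one vector, and the dimension formula for sums and intersections\<close>

lemma span_insert_subspace:
  assumes "poly2.subspace V"
  shows "f \<in> poly2.span (insert b V) \<longleftrightarrow> (\<exists>c. f - const2 c * b \<in> V)"
  using poly2.span_breakdown_eq[of f b V] poly2.span_eq_iff[THEN iffD2, OF assms] by metis

text \<open>A new exponent must appear, since equal sets of leading exponents would put
  \<open>b\<close> into \<open>V\<close>. It is the only one because the span is a line modulo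
  \<open>V\<close>.\<close>

lemma leads_span_insert:
  assumes V: "poly2.subspace V" "V \<subseteq> supported S" "inj_on w S" and b: "b \<in> supported S" "b \<notin> V"
  obtains n where "n \<notin> leads w V" "leads w (poly2.span (insert b V)) = insert n (leads w V)"
proof -
  let ?V = "poly2.span (insert b V)"
  have sub: "V \<subseteq> ?V" "b \<in> ?V"
    by (auto intro: poly2.span_base)
  have supp: "?V \<subseteq> supported S"
    using V(2) b(1) by (intro poly2.span_minimal subspace_supported) auto
  have "\<not> leads w ?V \<subseteq> leads w V"
    using leads_subset_imp_subset[OF V(1) sub(1) poly2.subspace_span supp V(3)] sub(2) b(2) by blast
  then obtain n where n: "n \<in> leads w ?V" "n \<notin> leads w V" by blast
  obtain g m where g: "g \<in> ?V" "w m = n" "Poly_Mapping.lookup g m = 1"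
    "\<forall>m'. Poly_Mapping.lookup g m' \<noteq> 0 \<longrightarrow> w m' \<le> n"
    using leads_monic[OF poly2.subspace_span n(1)] by blast
  obtain c0 where c0: "g - const2 c0 * b \<in> V"
    using g(1) span_insert_subspace[OF V(1)] by blast
  have "g \<notin> V"
    using n(2) g leadsI[of g V m w n] by (auto )
  then have "c0 \<noteq> 0"
    using c0 by auto
  \<comment> \<open>As \<open>c0\<close> is nonzero, \<open>g\<close> can replace \<open>b\<close>
    as generator of the span modulo \<open>V\<close>.\<close>
  have decomp: "\<exists>c. h - const2 c * g \<in> V" if h: "h \<in> ?V" for h
  proof -
    obtain c where c: "h - const2 c * b \<in> V"
      using h span_insert_subspace[OF V(1)] by blast
    have "(h - const2 c * b) - const2 (c / c0) * (g - const2 c0 * b) \<in> V"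
      by (intro poly2.subspace_diff[OF V(1)] poly2.subspace_scale[OF V(1)] c c0)
    moreover have "(h - const2 c * b) - const2 (c / c0) * (g - const2 c0 * b) = h - const2 (c / c0) * g"
      using \<open>c0 \<noteq> 0\<close> by (simp add: poly2.scale_right_diff_distrib)
    ultimately show ?thesis by auto
  qed
  \<comment> \<open>If \<open>h\<close> led at a further new exponent \<open>p\<close>, the element
    \<open>h - const2 c * g\<close> of \<open>V\<close> would lead at \<open>p\<close> (when
    \<open>p > n\<close> or \<open>c = 0\<close>) or else at \<open>n\<close>; neither is a leading
    exponent of \<open>V\<close>.\<close>
  have "p = n \<or> p \<in> leads w V" if p: "p \<in> leads w ?V" for p
  proof (rule ccontr)
    assume neg: "\<not> (p = n \<or> p \<in> leads w V)"
    obtain h mp where h: "h \<in> ?V" "w mp = p" "Poly_Mapping.lookup h mp = 1"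
      "\<forall>m'. Poly_Mapping.lookup h m' \<noteq> 0 \<longrightarrow> w m' \<le> p"
      using leads_monic[OF poly2.subspace_span p] by blast
    obtain c where c: "h - const2 c * g \<in> V"
      using decomp h(1) by blast
    have le: "w m' \<le> p \<or> c \<noteq> 0 \<and> w m' \<le> n"
      if "Poly_Mapping.lookup (h - const2 c * g) m' \<noteq> 0" for m'
      using that h(4) g(4) by (metis diff_zero lookup_const2_mult lookup_minus mult_eq_0_iff)
    show False
    proof (cases "p > n \<or> c = 0")
      case True
      then have "c * Poly_Mapping.lookup g mp = 0"
        using h(2) g(4) leD by auto
      then have "p \<in> leads w V"
      proof (intro leadsI[OF c, of mp])
        show "w m' \<le> p" if "Poly_Mapping.lookup (h - const2 c * g) m' \<noteq> 0" for m'
          using le[OF that] True by auto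
      qed (use h(2,3) in \<open>auto simp: lookup_minus\<close>)
      with neg show False by blast
    next
      case False
      with neg have "p < n" "c \<noteq> 0" by auto
      then have "Poly_Mapping.lookup h m = 0"
        using h(4) g(2) leD by blast
      then have "n \<in> leads w V"
      proof (intro leadsI[OF c, of m])
        show "w m' \<le> n" if "Poly_Mapping.lookup (h - const2 c * g) m' \<noteq> 0" for m'
          using le[OF that] \<open>p < n\<close> by auto
      qed (use g(2,3) \<open>c \<noteq> 0\<close> in \<open>simp_all add: lookup_minus\<close>)
      with n(2) show False by blast
    qed
  qed
  with n(1) leads_mono[OF sub(1), of w] have "leads w ?V = insert n (leads w V)"
    by blast
  with n(2) show thesis by (rule that)
qed

lemma card_leads_sum_Int:
  assumes A: "poly2.subspace A" "A \<subseteq> supported S" and B: "poly2.subspace B" "B \<subseteq> supported S"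
    and S: "finite S" "inj_on w S"
  shows "card (leads w A) + card (leads w B)
    = card (leads w (poly2.span (A \<union> B))) + card (leads w (A \<inter> B))"
  using A
proof (induction "card (w ` S) - card (leads w A)" arbitrary: A rule: less_induct)
  case less
  have fin: "finite (leads w V)" if "V \<subseteq> supported S" for V :: "'a poly2 set"
    using finite_subset[OF leads_supported[OF that]] S(1) by simp
  show ?case
  proof (cases "B \<subseteq> A")
    case True
    then show ?thesis
      using less.prems(1)
      by (simp add: Un_absorb2 Int_absorb1 poly2.span_eq_iff[THEN iffD2] del: poly2.span_eq_iff)
  next
    case False
    then obtain b where b: "b \<in> B" "b \<notin> A" by blast
    let ?A = "poly2.span (insert b A)"
    have bS: "b \<in> supported S" using b(1) B(2) by blast
    have suppA: "?A \<subseteq> supported S"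
      using less.prems(2) bS by (intro poly2.span_minimal subspace_supported) auto
    have card_insert: "card (leads w (poly2.span (insert b V))) = Suc (card (leads w V))"
      if V: "poly2.subspace V" "V \<subseteq> A" for V
    proof -
      have VS: "V \<subseteq> supported S" "b \<notin> V" using V(2) less.prems(2) b(2) by auto
      obtain n where "n \<notin> leads w V" "leads w (poly2.span (insert b V)) = insert n (leads w V)"
        by (rule leads_span_insert[OF V(1) VS(1) S(2) bS VS(2)])
      with fin[OF VS(1)] show ?thesis by simp
    qed
    have cardA: "card (leads w ?A) = Suc (card (leads w A))"
      using card_insert less.prems(1) by blast
    \<comment> \<open>The modular law for the line through \<open>b\<close>, which lies in
      \<open>B\<close>.\<close>
    have Int: "?A \<inter> B = poly2.span (insert b (A \<inter> B))"
    proof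
      show "poly2.span (insert b (A \<inter> B)) \<subseteq> ?A \<inter> B"
        using b(1) B(1) by (intro poly2.span_minimal poly2.subspace_inter) (auto intro: poly2.span_base)
      show "?A \<inter> B \<subseteq> poly2.span (insert b (A \<inter> B))"
      proof
        fix f assume f: "f \<in> ?A \<inter> B"
        then obtain c where c: "f - const2 c * b \<in> A"
          using span_insert_subspace[OF less.prems(1)] by auto
        moreover have "f - const2 c * b \<in> B"
          using f b(1) B(1) by (auto intro: poly2.subspace_diff poly2.subspace_scale)
        ultimately show "f \<in> poly2.span (insert b (A \<inter> B))"
          using span_insert_subspace[OF poly2.subspace_inter[OF less.prems(1) B(1)]] by auto
      qed
    qed
    have cardI: "card (leads w (?A \<inter> B)) = Suc (card (leads w (A \<inter> B)))"
      unfolding Int by (intro card_insert poly2.subspace_inter less.prems(1) B(1)) blast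
    have Un: "poly2.span (?A \<union> B) = poly2.span (A \<union> B)"
    proof
      show "poly2.span (?A \<union> B) \<subseteq> poly2.span (A \<union> B)"
        using b(1) by (intro poly2.span_minimal Un_least) (auto intro: poly2.span_base)
      show "poly2.span (A \<union> B) \<subseteq> poly2.span (?A \<union> B)"
        by (intro poly2.span_mono) (auto intro: poly2.span_base)
    qed
    have "card (leads w ?A) \<le> card (w ` S)"
      using leads_supported[OF suppA] S(1) by (intro card_mono) auto
    then have "card (leads w ?A) + card (leads w B)
        = card (leads w (poly2.span (?A \<union> B))) + card (leads w (?A \<inter> B))"
      using cardA suppA by (intro less.hyps) auto
    then show ?thesis
      using cardA cardI Un by simp
  qed
qed

subsection \<open>Dimensions in quotients of the polynomial ring\<close>

lemma poly2_ring_simps [simp]: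
  "carrier poly2_ring = UNIV" "monoid.mult poly2_ring = (*)" "ring.add poly2_ring = (+)"
  "\<zero>\<^bsub>poly2_ring\<^esub> = 0" "\<one>\<^bsub>poly2_ring\<^esub> = 1"
  by (simp_all add: ring_of_type_algebra_def fun_eq_iff)

lemma poly2_ring: "ring (poly2_ring :: 'k::field poly2 ring)"
  by (rule ring_from_type_algebra)

lemma poly2_idealD:
  assumes "ideal (I :: 'k::field poly2 set) poly2_ring"
  shows "0 \<in> I" "f \<in> I \<Longrightarrow> g \<in> I \<Longrightarrow> f + g \<in> I" "f \<in> I \<Longrightarrow> h * f \<in> I" "f \<in> I \<Longrightarrow> f * h \<in> I"
  using additive_subgroup.zero_closed[OF ideal.axioms(1)[OF assms]]
    additive_subgroup.a_closed[OF ideal.axioms(1)[OF assms], of f g]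
    ideal.I_l_closed[OF assms, of f h] ideal.I_r_closed[OF assms, of f h] by simp_all

lemma poly2_idealI:
  assumes "poly2.subspace I" "\<And>f h. f \<in> I \<Longrightarrow> h * f \<in> I"
  shows "ideal (I :: 'k::field poly2 set) poly2_ring"
proof (rule idealI[OF poly2_ring])
  have grp: "abelian_group (poly2_ring :: 'k poly2 ring)"
    by (rule ring.is_abelian_group[OF poly2_ring])
  have "inv\<^bsub>add_monoid poly2_ring\<^esub> f = - f" for f :: "'k poly2"
    using abelian_group.minus_equality[OF grp, of "- f" f] by (simp add: a_inv_def)
  then show "subgroup I (add_monoid poly2_ring)"
    using poly2.subspace_0[OF assms(1)] poly2.subspace_add[OF assms(1)] poly2.subspace_neg[OF assms(1)]
    by (intro subgroup.intro) auto
qed (use assms(2) in \<open>auto simp: mult.commute\<close>)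

lemma subspace_ideal:
  assumes "ideal (I :: 'k::field poly2 set) poly2_ring"
  shows "poly2.subspace I"
  using poly2_idealD[OF assms] by (intro poly2.subspaceI)

lemma residue_class_hom:
  assumes "ideal (I :: 'k::field poly2 set) poly2_ring"
  shows "ring_hom_ring poly2_ring (quot I) (residue_class I)"
proof -
  have "residue_class I = (+>\<^bsub>poly2_ring\<^esub>) I"
    by (simp add: residue_class_def fun_eq_iff)
  then show ?thesis
    using ideal.rcos_ring_hom_ring[OF assms] by simp
qed

lemma residue_class_eq_iff:
  assumes "ideal (I :: 'k::field poly2 set) poly2_ring"
  shows "residue_class I f = residue_class I g \<longleftrightarrow> f - g \<in> I"
proof -
  have rc: "residue_class I h = {f. f - h \<in> I}" for h
    by (force simp: residue_class_def a_r_coset_def r_coset_def)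
  show ?thesis
  proof
    assume "residue_class I f = residue_class I g"
    moreover have "f \<in> residue_class I f"
      using poly2_idealD(1)[OF assms] by (simp add: rc)
    ultimately show "f - g \<in> I"
      by (simp add: rc)
  next
    assume fg: "f - g \<in> I"
    have "h - f \<in> I \<longleftrightarrow> h - g \<in> I" for h
      using poly2.subspace_add[OF subspace_ideal[OF assms] _ fg, of "h - f"]
        poly2.subspace_diff[OF subspace_ideal[OF assms] _ fg, of "h - g"] by auto
    then show "residue_class I f = residue_class I g"
      by (simp add: rc)
  qed
qed

lemma quot_simps:
  assumes "ideal (I :: 'k::field poly2 set) poly2_ring"
  shows "carrier (quot I) = range (residue_class I)" "\<zero>\<^bsub>quot I\<^esub> = residue_class I 0"
    "residue_class I f \<oplus>\<^bsub>quot I\<^esub> residue_class I g = residue_class I (f + g)"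
    "residue_class I f \<otimes>\<^bsub>quot I\<^esub> residue_class I g = residue_class I (f * g)"
    "\<one>\<^bsub>quot I\<^esub> = residue_class I 1"
proof -
  interpret ring_hom_ring poly2_ring "quot I" "residue_class I"
    by (rule residue_class_hom[OF assms])
  show "carrier (quot I) = range (residue_class I)"
    by (auto simp: FactRing_def A_RCOSETS_def' residue_class_def)
  show "\<zero>\<^bsub>quot I\<^esub> = residue_class I 0" "\<one>\<^bsub>quot I\<^esub> = residue_class I 1"
    "residue_class I f \<oplus>\<^bsub>quot I\<^esub> residue_class I g = residue_class I (f + g)"
    "residue_class I f \<otimes>\<^bsub>quot I\<^esub> residue_class I g = residue_class I (f * g)"
    using hom_zero hom_one hom_add[of f g] hom_mult[of f g] by simp_all
qed

lemma truncation_mono: "n \<le> n' \<Longrightarrow> truncation w n V \<subseteq> truncation w n' V"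
  unfolding truncation_def by force

text \<open>The filtration by leading weight is followed into the quotient. At a weight led by an
  element of \<open>I\<close> the top term can be removed modulo \<open>I\<close>, so nothing is
  gained; at any other leading weight of \<open>V\<close> the image grows by exactly one
  dimension.\<close>

lemma dimension_residue_class_image:
  assumes I: "ideal (I :: 'k::field poly2 set) poly2_ring"
    and V: "poly2.subspace V" "V \<subseteq> supported S" and S: "finite S" "inj_on w S"
  shows "ring.dimension (quot I) (card (leads w V) - card (leads w (V \<inter> I))) (scalars I) (residue_class I ` V)"
proof -
  interpret Q: ring "quot I"
    by (rule ideal.quotient_is_ring[OF I])
  let ?r = "residue_class I" and ?L = "leads w V - leads w (V \<inter> I)"
  note qs = quot_simps[OF I]
  have dim: "Q.dimension (card {p \<in> ?L. p < n}) (scalars I) (?r ` truncation w n V)" for n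
  proof (induction n)
    case 0
    have "truncation w 0 V = {0}"
      using poly2.subspace_0[OF V(1)] by (auto simp: truncation_def intro!: poly_mapping_eqI)
    then show ?case
      using Q.zero_dim[of "scalars I"] qs(2) by simp
  next
    case (Suc n)
    have less_Suc: "{p \<in> ?L. p < Suc n} = (if n \<in> ?L then insert n {p \<in> ?L. p < n} else {p \<in> ?L. p < n})"
      by (auto simp: less_Suc_eq)
    consider "n \<notin> leads w V" | "n \<in> leads w (V \<inter> I)" | "n \<in> ?L" by blast
    then show ?case
    proof cases
      case 1
      then show ?thesis
        using Suc truncation_Suc_no_lead[OF 1] less_Suc by simp
    next
      case 2
      obtain g m where g: "g \<in> V \<inter> I" "w m = n" "Poly_Mapping.lookup g m = 1"
        "\<forall>m'. Poly_Mapping.lookup g m' \<noteq> 0 \<longrightarrow> w m' \<le> n"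
        using leads_monic[OF poly2.subspace_inter[OF V(1) subspace_ideal[OF I]] 2] by blast
      have "?r f \<in> ?r ` truncation w n V" if f: "f \<in> truncation w (Suc n) V" for f
      proof (rule image_eqI)
        show "f - const2 (Poly_Mapping.lookup f m) * g \<in> truncation w n V"
          using truncation_Suc_lead[OF V S(2) _ g(2-4) f] g(1) by blast
        show "?r f = ?r (f - const2 (Poly_Mapping.lookup f m) * g)"
          using g(1) poly2_idealD(3)[OF I] by (simp add: residue_class_eq_iff[OF I])
      qed
      then have "?r ` truncation w (Suc n) V = ?r ` truncation w n V"
        using truncation_mono[of n "Suc n" w V] by auto
      then show ?thesis
        using Suc 2 less_Suc by simp
    next
      case 3
      then obtain g m where g: "g \<in> V" "w m = n" "Poly_Mapping.lookup g m = 1"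
        "\<forall>m'. Poly_Mapping.lookup g m' \<noteq> 0 \<longrightarrow> w m' \<le> n"
        using leads_monic[OF V(1)] by blast
      \<comment> \<open>Were the class of \<open>g\<close> already reached by some \<open>u\<close>
        of lower weight, \<open>g - u\<close> would lie in \<open>I\<close> and still lead at
        \<open>n\<close>.\<close>
      have "?r g \<notin> ?r ` truncation w n V"
      proof
        assume "?r g \<in> ?r ` truncation w n V"
        then obtain u where u: "u \<in> truncation w n V" "g - u \<in> I"
          by (auto simp: residue_class_eq_iff[OF I])
        have "n \<in> leads w (V \<inter> I)"
        proof (rule leadsI)
          show "g - u \<in> V \<inter> I"
            using u g(1) poly2.subspace_diff[OF V(1)] by (simp add: truncation_def)
          have "Poly_Mapping.lookup u m = 0"
            using u(1) g(2) unfolding truncation_def by blast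
          then show "Poly_Mapping.lookup (g - u) m \<noteq> 0"
            using g(3) by (simp add: lookup_minus)
          show "w m' \<le> n" if "Poly_Mapping.lookup (g - u) m' \<noteq> 0" for m'
          proof (cases "Poly_Mapping.lookup u m' = 0")
            case True
            with that g(4) show ?thesis by (simp add: lookup_minus)
          next
            case False
            with u(1) show ?thesis by (simp add: truncation_def less_imp_le)
          qed
        qed (fact g(2))
        with 3 show False by blast
      qed
      moreover have "Q.line_extension (scalars I) (?r g) (?r ` truncation w n V) = ?r ` truncation w (Suc n) V"
      proof (intro equalityI subsetI)
        fix a assume "a \<in> Q.line_extension (scalars I) (?r g) (?r ` truncation w n V)"
        then obtain c u where u: "u \<in> truncation w n V" and a: "a = ?r (const2 c * g + u)"
          by (auto simp: Q.line_extension_mem_iff scalars_def qs)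
        have "const2 c * g + u \<in> V"
          using u g(1) by (auto simp: truncation_def intro!: poly2.subspace_add poly2.subspace_scale V(1))
        moreover have "w m' < Suc n" if "Poly_Mapping.lookup (const2 c * g + u) m' \<noteq> 0" for m'
        proof (cases "Poly_Mapping.lookup u m' = 0")
          case True
          with that g(4) show ?thesis by (auto simp: lookup_add less_Suc_eq_le)
        next
          case False
          with u show ?thesis by (simp add: truncation_def less_SucI)
        qed
        ultimately show "a \<in> ?r ` truncation w (Suc n) V"
          using a by (auto simp: truncation_def)
      next
        fix a assume "a \<in> ?r ` truncation w (Suc n) V"
        then obtain f where f: "f \<in> truncation w (Suc n) V" "a = ?r f" by blast
        let ?c = "const2 (Poly_Mapping.lookup f m)" and ?u = "f - const2 (Poly_Mapping.lookup f m) * g"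
        have "?u \<in> truncation w n V"
          by (rule truncation_Suc_lead[OF V S(2) g f(1)])
        moreover have "a = ?r ?c \<otimes>\<^bsub>quot I\<^esub> ?r g \<oplus>\<^bsub>quot I\<^esub> ?r ?u"
          using f(2) by (simp add: qs)
        ultimately show "a \<in> Q.line_extension (scalars I) (?r g) (?r ` truncation w n V)"
          unfolding Q.line_extension_mem_iff scalars_def by blast
      qed
      ultimately have "Q.dimension (Suc (card {p \<in> ?L. p < n})) (scalars I) (?r ` truncation w (Suc n) V)"
        using Q.Suc_dim[OF _ _ Suc, of "?r g"] qs(1) by simp
      moreover have "card {p \<in> ?L. p < Suc n} = Suc (card {p \<in> ?L. p < n})"
        using 3 less_Suc by simp
      ultimately show ?thesis
        by (simp only:)
    qed
  qed
  obtain N where N: "\<forall>n \<in> w ` S. n < N"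
    using finite_nat_set_iff_bounded[of "w ` S"] S(1) by auto
  have "truncation w N V = V"
    using V(2) N by (auto simp: truncation_def supported_def)
  moreover have "{p \<in> ?L. p < N} = ?L"
    using leads_supported[OF V(2)] N by blast
  moreover have "card ?L = card (leads w V) - card (leads w (V \<inter> I))"
  proof (rule card_Diff_subset)
    show sub: "leads w (V \<inter> I) \<subseteq> leads w V"
      by (rule leads_mono) blast
    show "finite (leads w (V \<inter> I))"
      using finite_subset[OF subset_trans[OF sub leads_supported[OF V(2)]]] S(1) by simp
  qed
  ultimately show ?thesis
    using dim[of N] by simp
qed

section \<open>Hilbert function and socle type as counts of leading exponents\<close>

lemma forms_eq_supported: "forms i = supported {m. total_deg m = i}"
  by (auto simp: forms_def supported_def in_keys_iff)

lemma finite_total_deg: "finite {m. total_deg m = i}"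
  by (rule finite_subset[of _ "{..i} \<times> {..i}"]) (auto simp: total_deg_def)

lemma inj_on_fst_total_deg: "inj_on fst {m. total_deg m = i}"
  by (auto simp: inj_on_def total_deg_def)

lemma fst_total_deg: "fst ` {m. total_deg m = i} = {..i}"
proof
  show "{..i} \<subseteq> fst ` {m. total_deg m = i}"
  proof
    fix a assume "a \<in> {..i}"
    then show "a \<in> fst ` {m. total_deg m = i}"
      by (intro image_eqI[of _ fst "(a, i - a)"]) (auto simp: total_deg_def)
  qed
qed (auto simp: total_deg_def)

text \<open>The degree \<open>i\<close> part of the colon ideal \<open>(I : M)\<close>, that is, the
  preimage in \<open>R\<close> of the socle in degree \<open>i\<close>.\<close>

definition annihilated_forms :: "'k::field poly2 set \<Rightarrow> nat \<Rightarrow> 'k poly2 set" where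
  "annihilated_forms I i = {f \<in> forms i. var_x * f \<in> I \<and> var_y * f \<in> I}"

lemma subspace_annihilated_forms:
  assumes "ideal (I :: 'k::field poly2 set) poly2_ring"
  shows "poly2.subspace (annihilated_forms I i)"
proof (rule poly2.subspaceI)
  fix c and f :: "'k poly2" assume "f \<in> annihilated_forms I i"
  then show "const2 c * f \<in> annihilated_forms I i"
    using poly2_idealD(3)[OF assms, of _ "const2 c"] poly2.subspace_scale[OF subspace_supported]
    by (auto simp: annihilated_forms_def forms_eq_supported mult.left_commute[of _ "const2 c"])
qed (use poly2_idealD(1,2)[OF assms] poly2.subspace_0[OF subspace_supported]
       poly2.subspace_add[OF subspace_supported] in
     \<open>auto simp: annihilated_forms_def forms_eq_supported distrib_left\<close>)

text \<open>The elements that multiply \<open>f\<close> into \<open>I\<close> form an ideal, so it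
  contains all of \<open>max_ideal\<close> once it contains both variables.\<close>

lemma socle_graded_eq:
  assumes I: "ideal (I :: 'k::field poly2 set) poly2_ring"
  shows "socle I \<inter> quot_graded I i = residue_class I ` annihilated_forms I i"
proof -
  have "(\<forall>m \<in> max_ideal. residue_class I m \<otimes>\<^bsub>quot I\<^esub> residue_class I f = \<zero>\<^bsub>quot I\<^esub>)
      \<longleftrightarrow> var_x * f \<in> I \<and> var_y * f \<in> I" (is "?L \<longleftrightarrow> ?R") for f
  proof -
    have L: "?L \<longleftrightarrow> max_ideal \<subseteq> {m. m * f \<in> I}"
      by (auto simp: quot_simps[OF I] residue_class_eq_iff[OF I])
    have "ideal {m. m * f \<in> I} poly2_ring"
      using poly2_idealD[OF I]
      by (intro poly2_idealI poly2.subspaceI) (auto simp: distrib_right mult.assoc)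
    then have "max_ideal \<subseteq> {m. m * f \<in> I}" if ?R
      unfolding max_ideal_def using that by (intro ring.genideal_minimal[OF poly2_ring]) auto
    moreover have "var_x \<in> max_ideal" "var_y \<in> max_ideal"
      unfolding max_ideal_def using ring.genideal_self[OF poly2_ring, of "{var_x, var_y}"] by auto
    ultimately show ?thesis
      unfolding L by blast
  qed
  then show ?thesis
    by (auto simp: socle_def quot_graded_def annihilated_forms_def quot_simps(1)[OF I])
qed

lemma finite_leads_forms: "V \<subseteq> forms i \<Longrightarrow> finite (leads fst V)"
  by (rule finite_subset[OF leads_supported finite_imageI[OF finite_total_deg]])
     (simp add: forms_eq_supported)

lemma subfield_range_const2: "subfield (range const2) (poly2_ring :: 'k::field poly2 ring)"
proof -
  let ?k = "ring_of_type_algebra :: 'k ring"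
  have const2: "const2 (a + b) = const2 a + const2 b" "const2 (a * b) = const2 a * const2 b"
    "const2 1 = 1" for a b :: 'k
    by (simp_all add: const2_def single_add mult_single flip: zero_prod_def)
  have "ring_hom_ring ?k poly2_ring const2"
  proof (rule ring_hom_ringI2[OF ring_from_type_algebra poly2_ring])
    show "const2 \<in> ring_hom ?k poly2_ring"
      by (rule ring_hom_memI) (simp_all add: const2 ring_of_type_algebra_def)
  qed
  moreover have "subfield (carrier ?k) ?k"
    by (rule field.carrier_is_subfield[OF field_from_type_algebra])
  ultimately have "subfield (const2 ` carrier ?k) poly2_ring"
    by (rule ring_hom_ring.img_is_subfield(2)) simp
  then show ?thesis
    by (simp add: ring_of_type_algebra_def)
qed

text \<open>Properness keeps the image of \<open>1\<close> nonzero. The scalars must form a field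
  for dimensions to be unique.\<close>

lemma subfield_scalars:
  assumes I: "ideal (I :: 'k::field poly2 set) poly2_ring" and "1 \<notin> I"
  shows "subfield (scalars I) (quot I)"
  unfolding scalars_def
  using ring_hom_ring.img_is_subfield(2)[OF residue_class_hom[OF I] subfield_range_const2] assms(2)
  by (simp add: quot_simps[OF I] residue_class_eq_iff[OF I])

text \<open>Uniqueness of dimension turns the computed value into an equivalence; the additive form
  avoids truncated subtraction.\<close>

lemma dimension_residue_class_iff:
  assumes I: "ideal (I :: 'k::field poly2 set) poly2_ring" "1 \<notin> I"
    and V: "poly2.subspace V" "V \<subseteq> forms i"
  shows "ring.dimension (quot I) n (scalars I) (residue_class I ` V)
    \<longleftrightarrow> n + card (leads fst (V \<inter> I)) = card (leads fst V)"
proof -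
  interpret Q: ring "quot I"
    by (rule ideal.quotient_is_ring[OF I(1)])
  have "Q.dimension (card (leads fst V) - card (leads fst (V \<inter> I))) (scalars I) (residue_class I ` V)"
    using dimension_residue_class_image[OF I(1) V(1) _ finite_total_deg inj_on_fst_total_deg] V(2)
    by (simp add: forms_eq_supported)
  moreover have "card (leads fst (V \<inter> I)) \<le> card (leads fst V)"
    by (intro card_mono finite_leads_forms[OF V(2)] leads_mono) blast
  ultimately show ?thesis
    using Q.dimension_is_inj[OF subfield_scalars[OF I]] by (metis add.commute le_add_diff_inverse diff_add_inverse)
qed

text \<open>In degree \<open>i\<close> all of the exponents \<open>0\<close> to \<open>i\<close>
  lead, so \<open>H i\<close> is the codimension of the degree \<open>i\<close> part of
  \<open>I\<close>.\<close>

lemma has_hilbert_function_iff: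
  assumes I: "ideal (I :: 'k::field poly2 set) poly2_ring" "1 \<notin> I"
  shows "has_hilbert_function I H \<longleftrightarrow> (\<forall>i. H i + card (leads fst (forms i \<inter> I)) = Suc i)"
proof -
  have "card (leads fst (forms i :: 'k poly2 set)) = Suc i" for i
    by (simp add: forms_eq_supported leads_supported_eq fst_total_deg)
  then have "ring.dimension (quot I) n (scalars I) (residue_class I ` forms i)
      \<longleftrightarrow> n + card (leads fst (forms i \<inter> I)) = Suc i" for i n
    using dimension_residue_class_iff[OF I, of "forms i" i]
    by (simp add: forms_eq_supported subspace_supported)
  then show ?thesis
    by (simp add: has_hilbert_function_def quot_graded_def)
qed

lemma forms_Int_ideal_subset: "ideal I poly2_ring \<Longrightarrow> forms i \<inter> I \<subseteq> annihilated_forms I i"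
  by (auto simp: annihilated_forms_def poly2_idealD(3))

lemma has_socle_type_iff:
  assumes I: "ideal (I :: 'k::field poly2 set) poly2_ring" "1 \<notin> I"
  shows "has_socle_type I ST \<longleftrightarrow>
    (\<forall>i. ST i + card (leads fst (forms i \<inter> I)) = card (leads fst (annihilated_forms I i)))"
proof -
  have "annihilated_forms I i \<inter> I = forms i \<inter> I" "annihilated_forms I i \<subseteq> forms i" for i
    using forms_Int_ideal_subset[OF I(1)] by (auto simp: annihilated_forms_def)
  then have "ring.dimension (quot I) n (scalars I) (residue_class I ` annihilated_forms I i)
      \<longleftrightarrow> n + card (leads fst (forms i \<inter> I)) = card (leads fst (annihilated_forms I i))" for i n
    using dimension_residue_class_iff[OF I subspace_annihilated_forms[OF I(1)]] by metis
  then show ?thesis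
    by (simp add: has_socle_type_def socle_graded_eq[OF I(1)])
qed

lemma proper_if_hilbert_function:
  assumes I: "ideal (I :: 'k::field poly2 set) poly2_ring"
    and H: "has_hilbert_function I H" "H i > 0"
  shows "1 \<notin> I"
proof
  assume "1 \<in> I"
  then have "I = UNIV"
    using poly2_idealD(4)[OF I, of 1] by auto
  then have triv: "residue_class I f = residue_class I 0" for f
    using residue_class_eq_iff[OF I] by blast
  interpret Q: ring "quot I"
    by (rule ideal.quotient_is_ring[OF I])
  have "Q.dimension (H i) (scalars I) (quot_graded I i)"
    using H(1) by (simp add: has_hilbert_function_def)
  then have "Q.dimension (Suc (H i - 1)) (scalars I) (quot_graded I i)"
    using H(2) by simp
  then obtain v E where v: "v \<in> carrier (quot I)" "v \<notin> E" "Q.dimension (H i - 1) (scalars I) E"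
    by (cases rule: Q.dimension.cases) auto
  have all_zero: "a = \<zero>\<^bsub>quot I\<^esub>" if "a \<in> carrier (quot I)" for a
    using that triv unfolding quot_simps(1,2)[OF I] by blast
  \<comment> \<open>Induction along the construction of the space: \<open>0 = 0 * u + 0\<close> lies
    in each line extension.\<close>
  have "\<zero>\<^bsub>quot I\<^esub> \<in> E" if "Q.dimension n K E" "K = scalars I" for n K E
    using that
  proof (induction rule: Q.dimension.induct)
    case (Suc_dim u E n K)
    have "const2 0 \<in> range (const2 :: 'k \<Rightarrow> _)" by blast
    then have mem: "residue_class I (const2 0) \<in> K"
      by (simp add: scalars_def Suc_dim.prems)
    have "residue_class I (const2 0) \<in> carrier (quot I)"
      by (simp add: quot_simps(1)[OF I])
    then have eq: "\<zero>\<^bsub>quot I\<^esub> = residue_class I (const2 0) \<otimes>\<^bsub>quot I\<^esub> u \<oplus>\<^bsub>quot I\<^esub> \<zero>\<^bsub>quot I\<^esub>"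
      using Suc_dim(1) by (intro all_zero[symmetric] Q.a_closed Q.m_closed Q.zero_closed)
    show ?case
      unfolding Q.line_extension_mem_iff
      by (rule bexI, rule bexI, rule eq) (fact Suc_dim.IH[OF Suc_dim.prems] mem)+
  qed simp
  from this[OF v(3) refl] show False
    using all_zero v(1,2) by blast
qed

subsection \<open>Multiplication by the variables\<close>

lemma lookup_var_x_mult [simp]:
  "Poly_Mapping.lookup (var_x * f) (0, b) = 0"
  "Poly_Mapping.lookup (var_x * f) (Suc a, b) = Poly_Mapping.lookup f (a, b)"
proof -
  have "Poly_Mapping.lookup (var_x * f) k = Sum_any (\<lambda>q. Poly_Mapping.lookup f q when k = (1, 0) + q)" for k
    by (simp add: lookup_mult var_x_def lookup_single when_mult)
  moreover have "(Suc a, b) = (1, 0) + q \<longleftrightarrow> q = (a, b)" "(0, b) \<noteq> (1, 0) + q" for q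
    by (cases q; auto)+
  ultimately show "Poly_Mapping.lookup (var_x * f) (0, b) = 0"
    "Poly_Mapping.lookup (var_x * f) (Suc a, b) = Poly_Mapping.lookup f (a, b)"
    by simp_all
qed

lemma lookup_var_y_mult [simp]:
  "Poly_Mapping.lookup (var_y * f) (a, 0) = 0"
  "Poly_Mapping.lookup (var_y * f) (a, Suc b) = Poly_Mapping.lookup f (a, b)"
proof -
  have "Poly_Mapping.lookup (var_y * f) k = Sum_any (\<lambda>q. Poly_Mapping.lookup f q when k = (0, 1) + q)" for k
    by (simp add: lookup_mult var_y_def lookup_single when_mult)
  moreover have "(a, Suc b) = (0, 1) + q \<longleftrightarrow> q = (a, b)" "(a, 0) \<noteq> (0, 1) + q" for q
    by (cases q; auto)+
  ultimately show "Poly_Mapping.lookup (var_y * f) (a, 0) = 0"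
    "Poly_Mapping.lookup (var_y * f) (a, Suc b) = Poly_Mapping.lookup f (a, b)"
    by simp_all
qed

lemma lookup_var_mult:
  "Poly_Mapping.lookup (var_x * f) m = (case fst m of 0 \<Rightarrow> 0 | Suc a \<Rightarrow> Poly_Mapping.lookup f (a, snd m))"
  "Poly_Mapping.lookup (var_y * f) m = (case snd m of 0 \<Rightarrow> 0 | Suc b \<Rightarrow> Poly_Mapping.lookup f (fst m, b))"
  by (cases m; auto split: nat.splits)+

lemma var_mult_supported_iff:
  "var_x * f \<in> supported S \<longleftrightarrow> f \<in> supported {m. (Suc (fst m), snd m) \<in> S}"
  "var_y * f \<in> supported S \<longleftrightarrow> f \<in> supported {m. (fst m, Suc (snd m)) \<in> S}"
proof -
  have "m \<in> S" if "\<forall>m. Poly_Mapping.lookup f m \<noteq> 0 \<longrightarrow> (Suc (fst m), snd m) \<in> S"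
    "Poly_Mapping.lookup (var_x * f) m \<noteq> 0" for m
    using that(1)[rule_format, of "(fst m - 1, snd m)"] that(2)
    by (cases m) (auto simp: lookup_var_mult split: nat.splits)
  moreover have "m \<in> S" if "\<forall>m. Poly_Mapping.lookup f m \<noteq> 0 \<longrightarrow> (fst m, Suc (snd m)) \<in> S"
    "Poly_Mapping.lookup (var_y * f) m \<noteq> 0" for m
    using that(1)[rule_format, of "(fst m, snd m - 1)"] that(2)
    by (cases m) (auto simp: lookup_var_mult split: nat.splits)
  moreover have "(Suc (fst m), snd m) \<in> S" if "\<forall>m. Poly_Mapping.lookup (var_x * f) m \<noteq> 0 \<longrightarrow> m \<in> S"
    "Poly_Mapping.lookup f m \<noteq> 0" for m
    using that(1)[rule_format, of "(Suc (fst m), snd m)"] that(2) by simp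
  moreover have "(fst m, Suc (snd m)) \<in> S" if "\<forall>m. Poly_Mapping.lookup (var_y * f) m \<noteq> 0 \<longrightarrow> m \<in> S"
    "Poly_Mapping.lookup f m \<noteq> 0" for m
    using that(1)[rule_format, of "(fst m, Suc (snd m))"] that(2) by simp
  ultimately show "var_x * f \<in> supported S \<longleftrightarrow> f \<in> supported {m. (Suc (fst m), snd m) \<in> S}"
    "var_y * f \<in> supported S \<longleftrightarrow> f \<in> supported {m. (fst m, Suc (snd m)) \<in> S}"
    unfolding supported_def mem_Collect_eq by blast+
qed

lemma var_mult_forms_iff:
  "var_x * f \<in> forms (Suc i) \<longleftrightarrow> f \<in> forms i" "var_y * f \<in> forms (Suc i) \<longleftrightarrow> f \<in> forms i"
  by (simp_all add: forms_eq_supported var_mult_supported_iff total_deg_def)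

text \<open>Weighing by the \<open>x\<close>-exponent separates the variables: \<open>x\<close>
  shifts every leading exponent, while \<open>y\<close> fixes it. The upper bound rests on this
  asymmetry.\<close>

lemma leads_var_x_mult: "leads fst ((*) var_x ` V) = Suc ` leads fst V"
proof (intro equalityI subsetI)
  fix n assume "n \<in> leads fst ((*) var_x ` V)"
  then obtain f m where f: "f \<in> V" "Poly_Mapping.lookup (var_x * f) m \<noteq> 0" "fst m = n"
    "\<And>m'. Poly_Mapping.lookup (var_x * f) m' \<noteq> 0 \<Longrightarrow> fst m' \<le> n"
    unfolding leads_def by auto
  obtain a where a: "fst m = Suc a" "Poly_Mapping.lookup f (a, snd m) \<noteq> 0"
    using f(2) by (auto simp: lookup_var_mult split: nat.splits)
  have "a \<in> leads fst V"
    using f(1) a(2)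
  proof (rule leadsI)
    show "fst m' \<le> a" if "Poly_Mapping.lookup f m' \<noteq> 0" for m'
      using f(4)[of "(Suc (fst m'), snd m')"] that a(1) f(3) by simp
  qed simp
  then show "n \<in> Suc ` leads fst V"
    using a(1) f(3) by blast
next
  fix n assume "n \<in> Suc ` leads fst V"
  then obtain f m where f: "f \<in> V" "Poly_Mapping.lookup f m \<noteq> 0" "n = Suc (fst m)"
    "\<And>m'. Poly_Mapping.lookup f m' \<noteq> 0 \<Longrightarrow> fst m' \<le> fst m"
    unfolding leads_def by auto
  show "n \<in> leads fst ((*) var_x ` V)"
  proof (rule leadsI)
    show "var_x * f \<in> (*) var_x ` V" using f(1) by blast
    show "Poly_Mapping.lookup (var_x * f) (Suc (fst m), snd m) \<noteq> 0" using f(2) by simp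
    show "fst m' \<le> n" if "Poly_Mapping.lookup (var_x * f) m' \<noteq> 0" for m'
      using that f(3) f(4)[of "(fst m' - 1, snd m')"] by (auto simp: lookup_var_mult split: nat.splits)
  qed (simp add: f(3))
qed

lemma leads_var_y_mult: "leads fst ((*) var_y ` V) = leads fst V"
proof (intro equalityI subsetI)
  fix n assume "n \<in> leads fst ((*) var_y ` V)"
  then obtain f m where f: "f \<in> V" "Poly_Mapping.lookup (var_y * f) m \<noteq> 0" "fst m = n"
    "\<And>m'. Poly_Mapping.lookup (var_y * f) m' \<noteq> 0 \<Longrightarrow> fst m' \<le> n"
    unfolding leads_def by auto
  obtain b where b: "snd m = Suc b" "Poly_Mapping.lookup f (fst m, b) \<noteq> 0"
    using f(2) by (auto simp: lookup_var_mult split: nat.splits)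
  show "n \<in> leads fst V"
    using f(1) b(2)
  proof (rule leadsI)
    show "fst m' \<le> n" if "Poly_Mapping.lookup f m' \<noteq> 0" for m'
      using f(4)[of "(fst m', Suc (snd m'))"] that by simp
  qed (simp add: f(3))
next
  fix n assume "n \<in> leads fst V"
  then obtain f m where f: "f \<in> V" "Poly_Mapping.lookup f m \<noteq> 0" "n = fst m"
    "\<And>m'. Poly_Mapping.lookup f m' \<noteq> 0 \<Longrightarrow> fst m' \<le> fst m"
    unfolding leads_def by auto
  show "n \<in> leads fst ((*) var_y ` V)"
  proof (rule leadsI)
    show "var_y * f \<in> (*) var_y ` V" using f(1) by blast
    show "Poly_Mapping.lookup (var_y * f) (fst m, Suc (snd m)) \<noteq> 0" using f(2) by simp
    show "fst m' \<le> n" if "Poly_Mapping.lookup (var_y * f) m' \<noteq> 0" for m'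
      using that f(3) f(4)[of "(fst m', snd m' - 1)"] by (auto simp: lookup_var_mult split: nat.splits)
  qed (simp add: f(3))
qed

section \<open>The two inequalities between graded pieces of an ideal\<close>

lemma card_annihilated_forms_less:
  assumes "leads fst (annihilated_forms I i) \<noteq> {}"
  shows "card (leads fst (annihilated_forms I i)) < card (leads fst (forms (Suc i) \<inter> I))"
proof -
  let ?L = "leads fst (annihilated_forms I i)"
  have fin: "finite ?L"
    by (rule finite_leads_forms[of _ i]) (auto simp: annihilated_forms_def)
  have "(*) var_x ` annihilated_forms I i \<subseteq> forms (Suc i) \<inter> I"
    "(*) var_y ` annihilated_forms I i \<subseteq> forms (Suc i) \<inter> I"
    by (auto simp: annihilated_forms_def var_mult_forms_iff)
  from this[THEN leads_mono, of fst]
  have sub: "?L \<subseteq> leads fst (forms (Suc i) \<inter> I)" "Suc ` ?L \<subseteq> leads fst (forms (Suc i) \<inter> I)"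
    by (simp_all add: leads_var_x_mult leads_var_y_mult)
  \<comment> \<open>The successor of the largest exponent makes the inclusion strict.\<close>
  have "Suc (Max ?L) \<notin> ?L"
    using Max_ge[OF fin] by force
  moreover have "Suc (Max ?L) \<in> Suc ` ?L"
    using Max_in[OF fin assms] by blast
  ultimately have "?L \<subset> leads fst (forms (Suc i) \<inter> I)"
    using sub by blast
  then show ?thesis
    by (intro psubset_card_mono finite_leads_forms[of _ "Suc i"]) auto
qed

lemma subspace_var_mult:
  assumes "poly2.subspace V"
  shows "poly2.subspace ((*) h ` V)"
proof (rule poly2.subspaceI)
  fix c g assume "g \<in> (*) h ` V"
  then show "const2 c * g \<in> (*) h ` V"
    using poly2.subspace_scale[OF assms, of _ c] by (auto simp: mult.left_commute[of "const2 c"])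
next
  show "0 \<in> (*) h ` V"
    using poly2.subspace_0[OF assms] by (metis image_eqI mult_zero_right)
next
  fix f g assume "f \<in> (*) h ` V" "g \<in> (*) h ` V"
  then show "f + g \<in> (*) h ` V"
    using poly2.subspace_add[OF assms] by (auto simp flip: distrib_left)
qed

lemma var_x_y_common_multiple:
  assumes "var_x * g = var_y * h"
  obtains t where "g = var_y * t" "h = var_x * t"
proof
  \<comment> \<open>This is \<open>g\<close> divided by \<open>y\<close>. The terms of
    \<open>g\<close> free of \<open>y\<close>, which the shift drops, vanish because
    \<open>var_y * h\<close> has none.\<close>
  let ?t = "Poly_Mapping.map_key (\<lambda>m. (fst m, Suc (snd m))) g"
  have t: "Poly_Mapping.lookup ?t (a, b) = Poly_Mapping.lookup g (a, Suc b)" for a b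
    by (subst map_key.rep_eq) (auto simp: inj_on_def prod_eq_iff)
  have eq: "Poly_Mapping.lookup (var_x * g) m = Poly_Mapping.lookup (var_y * h) m" for m
    using assms by simp
  have "Poly_Mapping.lookup g (a, b) = Poly_Mapping.lookup (var_y * ?t) (a, b)" for a b
    using eq[of "(Suc a, 0)"] t by (cases b) simp_all
  then show "g = var_y * ?t"
    by (intro poly_mapping_eqI) auto
  have "Poly_Mapping.lookup h (a, b) = Poly_Mapping.lookup (var_x * ?t) (a, b)" for a b
    using eq[of "(a, Suc b)"] t by (cases a) simp_all
  then show "h = var_x * ?t"
    by (intro poly_mapping_eqI) auto
qed

text \<open>Multiplication by either variable preserves dimension, so the two multiples of the
  degree \<open>i + 1\<close> part account for the factor \<open>2\<close>; their sum lies in degree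
  \<open>i + 2\<close> of \<open>I\<close>.\<close>

lemma card_forms_Int_ideal_double:
  assumes I: "ideal (I :: 'k::field poly2 set) poly2_ring"
  shows "2 * card (leads fst (forms (Suc i) \<inter> I))
    \<le> card (leads fst (forms (Suc (Suc i)) \<inter> I)) + card (leads fst (annihilated_forms I i))"
proof -
  let ?W = "forms (Suc i) \<inter> I" and ?W' = "forms (Suc (Suc i)) \<inter> I"
  let ?A = "(*) var_x ` ?W" and ?B = "(*) var_y ` ?W"
  have W: "poly2.subspace (forms j \<inter> I)" for j
    using subspace_supported subspace_ideal[OF I] by (auto simp: forms_eq_supported intro: poly2.subspace_inter)
  have sub: "?A \<subseteq> ?W'" "?B \<subseteq> ?W'"
    using poly2_idealD(3)[OF I] by (auto simp: var_mult_forms_iff)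
  then have "card (leads fst ?A) + card (leads fst ?B)
      = card (leads fst (poly2.span (?A \<union> ?B))) + card (leads fst (?A \<inter> ?B))"
    by (intro card_leads_sum_Int[OF _ _ _ _ finite_total_deg[of "Suc (Suc i)"] inj_on_fst_total_deg]
        subspace_var_mult W) (auto simp: forms_eq_supported)
  moreover have "card (leads fst (poly2.span (?A \<union> ?B))) \<le> card (leads fst ?W')"
    using sub by (intro card_mono leads_mono poly2.span_minimal W finite_leads_forms[of _ "Suc (Suc i)"]) auto
  \<comment> \<open>An element \<open>x g = y h\<close> of both has \<open>g = y t\<close> and
    \<open>h = x t\<close>; hence both variables carry \<open>t\<close> into
    \<open>I\<close>.\<close>
  moreover have "?A \<inter> ?B \<subseteq> (*) var_x ` (*) var_y ` annihilated_forms I i"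
  proof
    fix f assume "f \<in> ?A \<inter> ?B"
    then obtain g h where gh: "f = var_x * g" "f = var_y * h" "g \<in> ?W" "h \<in> ?W" by blast
    then obtain t where t: "g = var_y * t" "h = var_x * t"
      using var_x_y_common_multiple by metis
    with gh have "t \<in> annihilated_forms I i"
      by (auto simp: annihilated_forms_def var_mult_forms_iff)
    with gh t show "f \<in> (*) var_x ` (*) var_y ` annihilated_forms I i" by blast
  qed
  then have "card (leads fst (?A \<inter> ?B)) \<le> card (leads fst ((*) var_x ` (*) var_y ` annihilated_forms I i))"
    by (intro card_mono leads_mono finite_leads_forms[of _ "Suc (Suc i)"])
       (auto simp: annihilated_forms_def var_mult_forms_iff)
  ultimately show ?thesis
    by (simp add: leads_var_x_mult leads_var_y_mult card_image)
qed

subsection \<open>Monomial ideals\<close>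

text \<open>\<open>D\<close> is closed under divisors and plays the role of the standard monomials.
  Every monomial of a product \<open>f * h\<close> is a multiple of one of \<open>f\<close>, so it
  stays outside \<open>D\<close>.\<close>

lemma ideal_supported_Compl:
  assumes "\<And>m m'. m + m' \<in> D \<Longrightarrow> m \<in> D"
  shows "ideal (supported (- D) :: 'k::field poly2 set) poly2_ring"
proof (rule poly2_idealI[OF subspace_supported])
  fix f h :: "'k poly2" assume f: "f \<in> supported (- D)"
  have "m \<notin> D" if "m \<in> Poly_Mapping.keys (f * h)" for m
  proof -
    have "m \<in> {a + b | a b. a \<in> Poly_Mapping.keys f \<and> b \<in> Poly_Mapping.keys h}"
      using that keys_mult[of f h] by (rule rev_subsetD)
    then obtain a b where "m = a + b" "a \<in> Poly_Mapping.keys f"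
      by blast
    with f assms[of a b] show ?thesis
      by (auto simp: supported_def in_keys_iff)
  qed
  then show "h * f \<in> supported (- D)"
    by (auto simp: supported_def in_keys_iff mult.commute)
qed

lemma graded_ideal_supported:
  assumes "ideal (supported S :: 'k::field poly2 set) poly2_ring"
  shows "graded_ideal (supported S :: 'k poly2 set)"
proof -
  have "hom_component i f \<in> supported S" if "f \<in> supported S" for f :: "'k poly2" and i
    unfolding hom_component_def
  proof (rule poly2.subspace_sum[OF subspace_supported])
    fix m assume "m \<in> {m \<in> Poly_Mapping.keys f. total_deg m = i}"
    with that show "Poly_Mapping.single m (Poly_Mapping.lookup f m) \<in> supported S"
      by (auto simp: supported_def in_keys_iff lookup_single when_def split: if_splits)
  qed
  with assms show ?thesis
    by (simp add: graded_ideal_def)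
qed

lemma supported_Int: "supported S \<inter> supported T = supported (S \<inter> T)"
  by (auto simp: supported_def)

lemma annihilated_forms_supported:
  "annihilated_forms (supported S) i
    = supported {m. total_deg m = i \<and> (Suc (fst m), snd m) \<in> S \<and> (fst m, Suc (snd m)) \<in> S}"
proof -
  have "{m. total_deg m = i} \<inter> ({m. (Suc (fst m), snd m) \<in> S} \<inter> {m. (fst m, Suc (snd m)) \<in> S})
      = {m. total_deg m = i \<and> (Suc (fst m), snd m) \<in> S \<and> (fst m, Suc (snd m)) \<in> S}"
    by auto
  moreover have "annihilated_forms (supported S) i
      = forms i \<inter> ({f. var_x * f \<in> supported S} \<inter> {f. var_y * f \<in> supported S})"
    by (auto simp: annihilated_forms_def)
  ultimately show ?thesis
    by (simp add: var_mult_supported_iff forms_eq_supported supported_Int)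
qed

lemma card_leads_supported_total_deg:
  assumes "S \<subseteq> {m. total_deg m = i}"
  shows "card (leads fst (supported S :: 'k::field poly2 set)) = card S"
  unfolding leads_supported_eq
  by (rule card_image) (rule inj_on_subset[OF inj_on_fst_total_deg assms])

text \<open>Each class has a representative supported in the finite set \<open>D\<close>. A
  descending chain of ideals thus becomes a descending chain of subspaces with finitely many leading
  exponents, and it is constant from the point where their number is minimal.\<close>

lemma artinian_quot_supported_Compl:
  assumes I: "ideal (supported (- D) :: 'k::field poly2 set) poly2_ring" and D: "finite D"
  shows "artinian (quot (supported (- D) :: 'k poly2 set))"
  unfolding artinian_def
proof (intro allI impI)
  let ?I = "supported (- D) :: 'k poly2 set"
  let ?r = "residue_class ?I"
  fix J assume J: "\<forall>n. ideal (J n) (quot ?I) \<and> J (Suc n) \<subseteq> J n"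
  \<comment> \<open>Any injection serves as weight here; \<open>fst\<close> would not do, since
    \<open>D\<close> meets several degrees.\<close>
  obtain w :: "nat \<times> nat \<Rightarrow> nat" where w: "inj_on w D"
    using finite_imp_inj_to_nat_seg[OF D] by blast
  define V where "V n = {f \<in> supported D. ?r f \<in> J n}" for n
  have V: "poly2.subspace (V n)" for n
  proof -
    have Jn: "ideal (J n) (quot ?I)"
      using J by blast
    note add = ideal.axioms(1)[OF Jn]
    show ?thesis
    proof (rule poly2.subspaceI)
      show "0 \<in> V n"
        using additive_subgroup.zero_closed[OF add]
        by (simp add: V_def quot_simps(2)[OF I] poly2.subspace_0[OF subspace_supported])
    next
      fix f g assume "f \<in> V n" "g \<in> V n"
      then show "f + g \<in> V n"
        using additive_subgroup.a_closed[OF add, of "?r f" "?r g"]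
        by (simp add: V_def quot_simps(3)[OF I] poly2.subspace_add[OF subspace_supported])
    next
      fix c f assume "f \<in> V n"
      then show "const2 c * f \<in> V n"
        using ideal.I_l_closed[OF Jn, of "?r f" "?r (const2 c)"]
        by (simp add: V_def quot_simps(1,4)[OF I] poly2.subspace_scale[OF subspace_supported])
    qed
  qed
  have mono: "J n \<subseteq> J m" if "m \<le> n" for m n
    using that
  proof (induction rule: dec_induct)
    case (step k)
    with J show ?case by blast
  qed simp
  have fin: "finite (leads w (V n))" for n
    using D by (intro finite_subset[OF leads_supported]) (auto simp: V_def)
  obtain N where N: "\<And>n. card (leads w (V N)) \<le> card (leads w (V n))"
    using ex_has_least_nat[of "\<lambda>_. True" 0 "\<lambda>n. card (leads w (V n))"] by blast
  have "J n = J N" if n: "n \<ge> N" for n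
  proof
    show "J n \<subseteq> J N" by (rule mono[OF n])
    have VnN: "V n \<subseteq> V N"
      using mono[OF n] by (auto simp: V_def)
    have "leads w (V n) = leads w (V N)"
      by (rule card_seteq[OF fin leads_mono[OF VnN] N])
    then have VNn: "V N \<subseteq> V n"
      by (intro leads_subset_imp_subset[OF V VnN V _ w]) (auto simp: V_def)
    show "J N \<subseteq> J n"
    proof
      fix a assume a: "a \<in> J N"
      then have "a \<in> carrier (quot ?I)"
        using J ideal.Icarr by metis
      then obtain f where f: "a = ?r f"
        by (auto simp: quot_simps(1)[OF I])
      \<comment> \<open>The part of \<open>f\<close> on the standard monomials; the discarded terms
        lie in the ideal.\<close>
      define g where "g = Abs_poly_mapping (\<lambda>m. Poly_Mapping.lookup f m when m \<in> D)"
      have g: "Poly_Mapping.lookup g m = (Poly_Mapping.lookup f m when m \<in> D)" for m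
        unfolding g_def by (subst lookup_Abs_poly_mapping) (use D in \<open>auto intro: finite_subset\<close>)
      have "f - g \<in> ?I"
        by (auto simp: supported_def lookup_minus g)
      then have "a = ?r g"
        by (simp add: f residue_class_eq_iff[OF I])
      moreover have "g \<in> supported D"
        by (auto simp: supported_def g)
      ultimately show "a \<in> J n"
        using a VNn by (auto simp: V_def)
    qed
  qed
  then show "\<exists>N. \<forall>n\<ge>N. J n = J N" by blast
qed

lemma monomial_ideal_of_staircase:
  fixes d :: "nat \<Rightarrow> nat" and \<mu> :: nat
  assumes \<mu>: "\<mu> > 0" and gt: "\<And>b. b < \<mu> \<Longrightarrow> b < d b"
    and step: "\<And>b. Suc b < \<mu> \<Longrightarrow> d (Suc b) \<le> Suc (d b)"
  shows "\<exists>I :: 'k::field poly2 set. graded_ideal I \<and> artinian (quot I)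
    \<and> has_hilbert_function I (\<lambda>i. card {b. b < \<mu> \<and> b \<le> i \<and> i < d b})
    \<and> has_socle_type I (\<lambda>i. card {b. b < \<mu> \<and> d b = Suc i \<and> \<not> (Suc b < \<mu> \<and> d (Suc b) = Suc (Suc i))})"
proof -
  \<comment> \<open>The standard monomials: in row \<open>b\<close> those of degree below
    \<open>d b\<close>, and none in the rows from \<open>mu\<close> on.\<close>
  define D where "D = {m. snd m < \<mu> \<and> total_deg m < d (snd m)}"
  let ?I = "supported (- D) :: 'k poly2 set"
  \<comment> \<open>Since \<open>d\<close> climbs by at most one per row, \<open>D\<close> is closed
    under divisors.\<close>
  have steps: "d (b + c) \<le> d b + c" if "b + c < \<mu>" for b c
    using that
  proof (induction c)
    case (Suc c)
    with step[of "b + c"] show ?case by simp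
  qed simp
  have I: "ideal ?I poly2_ring"
  proof (rule ideal_supported_Compl)
    fix m m' assume "m + m' \<in> D"
    then show "m \<in> D"
      using steps[of "snd m" "snd m'"] by (simp add: D_def total_deg_def)
  qed
  have "0 \<in> D"
    using \<mu> gt[of 0] by (simp add: D_def total_deg_def)
  then have proper: "1 \<notin> ?I"
    by (auto simp: supported_def lookup_one)
  have "finite D"
  proof (rule finite_subset)
    show "D \<subseteq> (\<Union>b < \<mu>. {..< d b} \<times> {b})"
      by (auto simp: D_def total_deg_def)
  qed simp
  have finite_deg: "finite {m. total_deg m = i \<and> P m}" for i P
    by (rule finite_subset[OF _ finite_total_deg[of i]]) auto
  have card_deg: "card {m. total_deg m = i \<and> P (snd m)} = card {b. b \<le> i \<and> P b}" for i P
    by (rule bij_betw_same_card[of snd], rule bij_betwI[where g = "\<lambda>b. (i - b, b)"])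
       (auto simp: total_deg_def)
  have nonD: "card (leads fst (forms i \<inter> ?I)) = card {m. total_deg m = i \<and> m \<notin> D}" for i
  proof -
    have "forms i \<inter> ?I = supported {m. total_deg m = i \<and> m \<notin> D}"
      by (auto simp: forms_eq_supported supported_def)
    then show ?thesis
      by (simp add: card_leads_supported_total_deg[of _ i] subset_iff)
  qed
  have D_deg: "total_deg m = i \<and> m \<in> D \<longleftrightarrow> total_deg m = i \<and> snd m < \<mu> \<and> i < d (snd m)" for m i
    by (auto simp: D_def)
  have "card {b. b < \<mu> \<and> b \<le> i \<and> i < d b} + card (leads fst (forms i \<inter> ?I)) = Suc i" for i
  proof -
    have "card {m. total_deg m = i \<and> m \<in> D} + card {m. total_deg m = i \<and> m \<notin> D}
        = card {m. total_deg m = i \<and> True}"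
      by (subst card_Un_disjoint[symmetric]) (auto intro!: finite_deg arg_cong[of _ _ card])
    also have "\<dots> = Suc i"
      by (subst card_deg) simp
    also have "card {m. total_deg m = i \<and> m \<in> D} = card {b. b < \<mu> \<and> b \<le> i \<and> i < d b}"
      unfolding D_deg card_deg[of i "\<lambda>b. b < \<mu> \<and> i < d b"] by (rule arg_cong[of _ _ card]) auto
    finally show ?thesis
      unfolding nonD .
  qed
  then have hilbert: "has_hilbert_function ?I (\<lambda>i. card {b. b < \<mu> \<and> b \<le> i \<and> i < d b})"
    using has_hilbert_function_iff[OF I proper] by blast
  let ?S = "\<lambda>i. {b. b < \<mu> \<and> d b = Suc i \<and> \<not> (Suc b < \<mu> \<and> d (Suc b) = Suc (Suc i))}"
  have "card (?S i) + card (leads fst (forms i \<inter> ?I)) = card (leads fst (annihilated_forms ?I i))" for i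
  proof -
    let ?T = "\<lambda>m. (Suc (fst m), snd m) \<in> - D \<and> (fst m, Suc (snd m)) \<in> - D"
    have lower: "m \<in> D" if "(Suc (fst m), snd m) \<in> D" for m
      using that by (simp add: D_def total_deg_def)
    \<comment> \<open>Leaving \<open>D\<close> in direction \<open>x\<close> forces
      \<open>d b = i + 1\<close>. The next row has \<open>d (b + 1) <= i + 2\<close>, so direction
      \<open>y\<close> stays in \<open>D\<close> exactly when that row exists and equality
      holds.\<close>
    have corner: "total_deg m = i \<and> ?T m \<and> m \<in> D \<longleftrightarrow> total_deg m = i \<and> snd m \<in> ?S i" for m
      using step[of "snd m"] by (auto simp: D_def total_deg_def)
    have nonD_T: "total_deg m = i \<and> ?T m \<and> m \<notin> D \<longleftrightarrow> total_deg m = i \<and> m \<notin> D" for m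
      using steps[of "snd m" 1] by (auto simp: D_def total_deg_def)
    have "card {m. total_deg m = i \<and> ?T m \<and> m \<in> D} + card {m. total_deg m = i \<and> ?T m \<and> m \<notin> D}
        = card {m. total_deg m = i \<and> ?T m}"
      by (subst card_Un_disjoint[symmetric]) (auto intro!: finite_deg arg_cong[of _ _ card])
    \<comment> \<open>The constraint \<open>b <= i\<close> is automatic from
      \<open>b < d b = i + 1\<close>.\<close>
    moreover have "{b. b \<le> i \<and> b \<in> ?S i} = ?S i"
      using gt by fastforce
    ultimately have "card (?S i) + card {m. total_deg m = i \<and> m \<notin> D} = card {m. total_deg m = i \<and> ?T m}"
      unfolding corner nonD_T card_deg[of i "\<lambda>b. b \<in> ?S i"] by simp
    moreover have "card (leads fst (annihilated_forms ?I i)) = card {m. total_deg m = i \<and> ?T m}"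
      unfolding annihilated_forms_supported
      by (rule card_leads_supported_total_deg[of _ i]) auto
    ultimately show ?thesis
      by (simp add: nonD)
  qed
  then have "has_socle_type ?I (\<lambda>i. card (?S i))"
    using has_socle_type_iff[OF I proper] by blast
  with hilbert graded_ideal_supported[OF I] artinian_quot_supported_Compl[OF I \<open>finite D\<close>]
  show ?thesis
    by blast
qed

subsection \<open>Words with prescribed ascents\<close>

text \<open>The staircase condition in list form; a letter may be followed by an arbitrary
  drop.\<close>

primrec small_steps :: "nat list \<Rightarrow> bool" where
  "small_steps [] \<longleftrightarrow> True"
| "small_steps (x # w) \<longleftrightarrow> (w \<noteq> [] \<longrightarrow> hd w \<le> Suc x) \<and> small_steps w"

primrec ascents :: "nat \<Rightarrow> nat list \<Rightarrow> nat" where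
  "ascents j [] = 0"
| "ascents j (x # w) = of_bool (x = j \<and> w \<noteq> [] \<and> hd w = Suc j) + ascents j w"

text \<open>A word with too few letters \<open>m\<close> receives fewer than \<open>n\<close>
  insertions, hence the hypothesis \<open>n <= count_list w m\<close> in the counting
  lemmas.\<close>

fun insert_after :: "nat \<Rightarrow> nat \<Rightarrow> nat list \<Rightarrow> nat list" where
  "insert_after m 0 w = w"
| "insert_after m (Suc n) [] = []"
| "insert_after m (Suc n) (x # w) =
    (if x = m then m # Suc m # insert_after m n w else x # insert_after m (Suc n) w)"

lemma insert_after_eq_Nil_iff [simp]: "insert_after m n w = [] \<longleftrightarrow> w = []"
  by (cases "(m, n, w)" rule: insert_after.cases) auto

lemma hd_insert_after [simp]: "hd (insert_after m n w) = hd w"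
  by (cases "(m, n, w)" rule: insert_after.cases) auto

lemma set_insert_after: "set w \<subseteq> {..m} \<Longrightarrow> set (insert_after m n w) \<subseteq> {..Suc m}"
  by (induction m n w rule: insert_after.induct) (auto split: if_splits)

lemma count_insert_after:
  "set w \<subseteq> {..m} \<Longrightarrow> n \<le> count_list w m \<Longrightarrow>
    count_list (insert_after m n w) j = (if j = Suc m then n else count_list w j)"
  by (induction m n w rule: insert_after.induct) (auto simp: count_list_0_iff split: if_splits)

lemma hd_le: "set w \<subseteq> {..m} \<Longrightarrow> w \<noteq> [] \<Longrightarrow> hd w \<le> m"
  using hd_in_set by blast

lemma ascents_eq_0: "set w \<subseteq> {..m} \<Longrightarrow> ascents m w = 0"
  by (induction w) (auto dest!: hd_le)

text \<open>An insertion breaks only a pair starting with \<open>m\<close>, which was no ascent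
  since no letter exceeds \<open>m\<close>. It creates one ascent from \<open>m\<close>, and the new
  pair starting with \<open>Suc m\<close> does not matter for \<open>j <= m\<close>.\<close>

lemma ascents_insert_after:
  "set w \<subseteq> {..m} \<Longrightarrow> n \<le> count_list w m \<Longrightarrow> j \<le> m \<Longrightarrow>
    ascents j (insert_after m n w) = (if j = m then n else ascents j w)"
proof (induction m n w rule: insert_after.induct)
  case (1 m w)
  then show ?case by (simp add: ascents_eq_0)
next
  case (3 m n x w)
  then have "w \<noteq> [] \<Longrightarrow> hd w \<le> m" by (auto dest!: hd_le)
  with 3 show ?case by (auto split: if_splits)
qed simp

lemma small_steps_insert_after:
  "set w \<subseteq> {..m} \<Longrightarrow> small_steps w \<Longrightarrow> small_steps (insert_after m n w)"
proof (induction m n w rule: insert_after.induct)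
  case (3 m n x w)
  then have "w \<noteq> [] \<Longrightarrow> hd w \<le> m" by (auto dest!: hd_le)
  with 3 show ?case by (auto split: if_splits)
qed simp_all

lemma ascents_replicate_append: "j \<noteq> x \<Longrightarrow> ascents j (replicate k x @ w) = ascents j w"
  by (induction k) auto

lemma small_steps_replicate_append:
  "set w \<subseteq> {..Suc x} \<Longrightarrow> small_steps w \<Longrightarrow> small_steps (replicate k x @ w)"
  by (induction k) (auto simp: hd_append dest!: hd_le)

lemma count_list_replicate: "count_list (replicate k x) y = (if x = y then k else 0)"
  by (induction k) auto

text \<open>The first bound supplies enough letters \<open>j\<close> to be followed, the second
  enough letters \<open>j + 1\<close> to follow them. Ascents from the top letter \<open>m\<close>
  only arise once \<open>m + 1\<close> is placed, hence the strict \<open>j < m\<close>.\<close>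

lemma exists_word:
  assumes "\<And>j. r j \<le> e j" "\<And>j. r j \<le> e (Suc j)"
  shows "\<exists>w. set w \<subseteq> {..m} \<and> small_steps w \<and> (\<forall>j\<le>m. count_list w j = e j) \<and> (\<forall>j<m. ascents j w = r j)"
proof (induction m)
  case 0
  show ?case
    using small_steps_replicate_append[of "[]" 0 "e 0"]
    by (intro exI[of _ "replicate (e 0) 0"]) (auto simp: count_list_replicate)
next
  case (Suc m)
  then obtain w where w: "set w \<subseteq> {..m}" "small_steps w"
    "\<forall>j\<le>m. count_list w j = e j" "\<forall>j<m. ascents j w = r j" by blast
  let ?u = "insert_after m (r m) w"
  \<comment> \<open>The surplus copies go to the front, where no letter precedes them, so they
    create no further ascent from \<open>m\<close>.\<close>
  let ?w = "replicate (e (Suc m) - r m) (Suc m) @ ?u"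
  have rm: "r m \<le> count_list w m"
    using w(3) assms(1) by simp
  have u: "set ?u \<subseteq> {..Suc m}"
    by (rule set_insert_after[OF w(1)])
  have "set ?w \<subseteq> {..Suc m}"
    using u by auto
  moreover have "small_steps ?w"
    using u small_steps_insert_after[OF w(1,2)] by (intro small_steps_replicate_append) auto
  moreover have "count_list ?w j = e j" if "j \<le> Suc m" for j
    using that w(3) assms(2)[of m] by (auto simp: count_list_replicate count_insert_after[OF w(1) rm])
  moreover have "ascents j ?w = r j" if "j < Suc m" for j
    using that w(4) by (simp add: ascents_replicate_append ascents_insert_after[OF w(1) rm])
  ultimately show ?case by blast
qed

lemma small_steps_nth: "small_steps w \<Longrightarrow> Suc b < length w \<Longrightarrow> w ! Suc b \<le> Suc (w ! b)"
proof (induction w arbitrary: b)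
  case (Cons x w)
  then show ?case
    by (cases b) (auto simp: hd_conv_nth)
qed simp

section \<open>Letter and ascent counts in terms of positions\<close>

lemma card_ascents:
  "card {b. Suc b < length w \<and> w ! b = j \<and> w ! Suc b = Suc j} = ascents j w"
proof (induction w)
  case (Cons x w)
  let ?A = "{b. Suc b < length w \<and> w ! b = j \<and> w ! Suc b = Suc j}"
  have "{b. Suc b < length (x # w) \<and> (x # w) ! b = j \<and> (x # w) ! Suc b = Suc j}
      = (if x = j \<and> w \<noteq> [] \<and> hd w = Suc j then {0} else {}) \<union> Suc ` ?A"
    (is "?L = ?R")
  proof (rule Set.set_eqI)
    fix b show "b \<in> ?L \<longleftrightarrow> b \<in> ?R"
      by (cases b) (auto simp: hd_conv_nth)
  qed
  moreover have "finite ?A"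
    by (rule finite_subset[of _ "{..<length w}"]) auto
  ultimately show ?case
    using Cons.IH by (simp add: card_image)
qed simp

lemma ascents_le_count: "ascents j w \<le> count_list w j"
  by (induction w) auto

lemma card_nth_eq: "card {b. b < length w \<and> w ! b = j} = count_list w j"
  unfolding count_list_eq_length_filter length_filter_conv_card
  by (rule arg_cong[of _ _ card]) auto

lemma card_nth_le:
  fixes w :: "nat list"
  shows "card {b. b < length w \<and> w ! b \<le> i} = (\<Sum>j\<le>i. count_list w j)"
proof -
  have "{b. b < length w \<and> w ! b \<le> i} = (\<Union>j\<in>{..i}. {b. b < length w \<and> w ! b = j})"
    by auto
  also have "card \<dots> = (\<Sum>j\<le>i. card {b. b < length w \<and> w ! b = j})"
    by (rule card_UN_disjoint) auto
  finally show ?thesis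
    by (simp only: card_nth_eq)
qed

subsection \<open>The classification\<close>

lemma first_diff_nonneg:
  assumes "\<forall>i < \<mu>. H i = i + 1" "H \<mu> \<le> \<mu>" "\<forall>i \<ge> \<mu>. H (i + 1) \<le> H i"
  shows "first_diff \<mu> H i \<ge> 0"
proof -
  \<comment> \<open>At \<open>i = mu > 0\<close> the difference is \<open>mu - H mu\<close>; at
    \<open>i = mu = 0\<close> the index \<open>i - 1\<close> truncates to \<open>0\<close> and the
    difference vanishes.\<close>
  consider "i < \<mu>" | "i = \<mu>" "i = 0" | "i = \<mu>" "i > 0" | "i > \<mu>" by linarith
  then show ?thesis
  proof cases
    case 3
    then show ?thesis
      using assms(1)[rule_format, of "i - 1"] assms(2) by (simp add: first_diff_def)
  next
    case 4
    then show ?thesis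
      using assms(3)[rule_format, of "i - 1"] by (simp add: first_diff_def)
  qed (simp_all add: first_diff_def)
qed

text \<open>The sum telescopes from \<open>H (mu - 1) = mu\<close>. Where \<open>H\<close> has
  reached \<open>0\<close>, the differences add up to \<open>mu\<close>, the number of rows of the
  staircase.\<close>

lemma sum_first_diff:
  assumes "\<mu> \<ge> 1" "\<forall>i < \<mu>. H i = i + 1"
  shows "int (H i) + (\<Sum>j\<le>i. first_diff \<mu> H j) = int (min \<mu> (Suc i))"
proof (induction i)
  case 0
  then show ?case using assms by (simp add: first_diff_def)
next
  case (Suc i)
  show ?case
  proof (cases "Suc i < \<mu>")
    case True
    then have "H (Suc i) = Suc (H i)" using assms(2) by simp
    with True Suc show ?thesis by (simp add: first_diff_def)
  next
    case False
    with Suc show ?thesis by (simp add: first_diff_def)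
  qed
qed

lemma socle_type_bounds:
  fixes H ST :: "nat \<Rightarrow> nat" and I :: "'k::field poly2 set"
  assumes H: "\<mu> \<ge> 1" "\<forall>i < \<mu>. H i = i + 1" "H \<mu> \<le> \<mu>" "\<forall>i \<ge> \<mu>. H (i + 1) \<le> H i"
    and I: "ideal I poly2_ring" "has_hilbert_function I H" "has_socle_type I ST"
  shows "first_diff \<mu> H (i + 1) - first_diff \<mu> H (i + 2) \<le> int (ST i)"
    and "int (ST i) \<le> first_diff \<mu> H (i + 1)"
proof -
  have "H 0 > 0" using H(1,2) by simp
  then have proper: "1 \<notin> I"
    by (rule proper_if_hilbert_function[OF I(1,2)])
  define l where "l i = card (leads fst (forms i \<inter> I))" for i
  define s where "s i = card (leads fst (annihilated_forms I i))" for i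
  have Hl: "H i + l i = Suc i" and Sl: "ST i + l i = s i" for i
    using I(2,3) unfolding has_hilbert_function_iff[OF I(1) proper] has_socle_type_iff[OF I(1) proper]
    by (simp_all add: l_def s_def)
  have lower: "2 * l (Suc i) \<le> l (Suc (Suc i)) + s i"
    unfolding l_def s_def by (rule card_forms_Int_ideal_double[OF I(1)])
  have upper: "s i = 0 \<or> s i < l (Suc i)"
    using card_annihilated_forms_less[of I i] unfolding l_def s_def
    by (cases "leads fst (annihilated_forms I i) = {}") simp_all
  have nonneg: "first_diff \<mu> H j \<ge> 0" for j
    by (rule first_diff_nonneg[OF H(2-4)])
  have "first_diff \<mu> H (i + 1) - first_diff \<mu> H (i + 2) \<le> int (ST i) \<and> int (ST i) \<le> first_diff \<mu> H (i + 1)"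
  proof (cases "Suc i < \<mu>")
    \<comment> \<open>Here \<open>I\<close> has no nonzero form of degree \<open>i + 1\<close>,
      hence there are no nonzero annihilated forms and the socle vanishes in degree
      \<open>i\<close>.\<close>
    case True
    then have "H (Suc i) = Suc (Suc i)" using H(2) by simp
    then have "s i = 0" using Hl[of "Suc i"] upper by simp
    then have "ST i = 0" using Sl[of i] by simp
    moreover have "first_diff \<mu> H (i + 1) = 0" using True by (simp add: first_diff_def)
    ultimately show ?thesis using nonneg[of "i + 2"] by simp
  next
    case False
    then have "first_diff \<mu> H (i + 1) = int (H i) - int (H (Suc i))"
      "first_diff \<mu> H (i + 2) = int (H (Suc i)) - int (H (Suc (Suc i)))"
      by (simp_all add: first_diff_def)
    \<comment> \<open>Substituting \<open>l i = i + 1 - H i\<close> and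
      \<open>s i = ST i + l i\<close> turns \<open>lower\<close> into the lower bound and the strict
      \<open>s i < l (Suc i)\<close> into \<open>ST i <= H i - H (Suc i)\<close>.\<close>
    then show ?thesis
      using lower upper Hl[of i] Hl[of "Suc i"] Hl[of "Suc (Suc i)"] Sl[of i] nonneg[of "i + 1"] by linarith
  qed
  then show "first_diff \<mu> H (i + 1) - first_diff \<mu> H (i + 2) \<le> int (ST i)"
    and "int (ST i) \<le> first_diff \<mu> H (i + 1)" by simp_all
qed

lemma exists_monomial_ideal:
  fixes H ST :: "nat \<Rightarrow> nat"
  assumes H: "\<mu> \<ge> 1" "\<forall>i < \<mu>. H i = i + 1" "H \<mu> \<le> \<mu>" "\<forall>i \<ge> \<mu>. H (i + 1) \<le> H i"
    and lim: "H \<longlonglongrightarrow> 0"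
    and bounds: "\<forall>i. first_diff \<mu> H (i + 1) - first_diff \<mu> H (i + 2) \<le> int (ST i)
                  \<and> int (ST i) \<le> first_diff \<mu> H (i + 1)"
  shows "\<exists>I :: 'k::field poly2 set.
    graded_ideal I \<and> artinian (quot I) \<and> has_hilbert_function I H \<and> has_socle_type I ST"
proof -
  define e where "e j = nat (first_diff \<mu> H j)" for j
  \<comment> \<open>The required number of ascents from \<open>j\<close>: the rows with
    \<open>d b = j\<close> that must not contribute to the socle in degree \<open>j - 1\<close>. At
    \<open>j = 0\<close> there is no such degree, and \<open>e 0 = 0\<close>.\<close>
  define r where "r j = (case j of 0 \<Rightarrow> 0 | Suc i \<Rightarrow> e (Suc i) - ST i)" for j
  have e: "first_diff \<mu> H j = int (e j)" for j
    using first_diff_nonneg[OF H(2-4)] by (simp add: e_def)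
  have ST_le: "ST i \<le> e (Suc i)" and le_ST: "e (Suc i) \<le> ST i + e (Suc (Suc i))" for i
    using bounds[rule_format, of i] by (simp_all add: e)
  have r: "r j \<le> e j" "r j \<le> e (Suc j)" for j
    using le_ST[of "j - 1"] by (auto simp: r_def split: nat.splits)
  have sum_e: "H i + (\<Sum>j\<le>i. e j) = min \<mu> (Suc i)" for i
    using sum_first_diff[OF H(1,2), of i] unfolding e by (simp flip: of_nat_sum of_nat_add)
  have "\<forall>\<^sub>F n in sequentially. H n = 0"
    using lim by (simp add: tendsto_discrete)
  then obtain N where N: "\<And>n. n \<ge> N \<Longrightarrow> H n = 0"
    by (auto simp: eventually_sequentially)
  define m where "m = N + \<mu>"
  have e_0: "e j = 0" if "j > m \<or> j < \<mu>" for j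
    using that N[of j] N[of "j - 1"] by (auto simp: e_def first_diff_def m_def)
  \<comment> \<open>With bound \<open>Suc m\<close> the ascent clause covers all
    \<open>j <= m\<close>; beyond that \<open>e\<close> and \<open>r\<close> vanish.\<close>
  obtain w where w: "set w \<subseteq> {..Suc m}" "small_steps w" "\<forall>j\<le>Suc m. count_list w j = e j"
    "\<forall>j<Suc m. ascents j w = r j"
    using exists_word[of r e "Suc m"] r by blast
  have count: "count_list w j = e j" for j
  proof (cases "j \<le> Suc m")
    case False
    then have "j \<notin> set w" using w(1) by auto
    with False show ?thesis by (simp add: e_0 count_list_0_iff)
  qed (use w(3) in simp)
  have ascents: "ascents j w = r j" for j
  proof (cases "j < Suc m")
    case False
    then show ?thesis
      using ascents_le_count[of j w] r(1)[of j] by (simp add: count e_0)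
  qed (use w(4) in simp)
  have "{b. b < length w \<and> w ! b \<le> Suc m} = {..<length w}"
    using w(1) nth_mem by fastforce
  \<comment> \<open>All letters are counted by the sum of the \<open>e j\<close>, which is
    \<open>mu\<close> since \<open>H (Suc m) = 0\<close>.\<close>
  then have len: "length w = \<mu>"
    using card_nth_le[of w "Suc m"] sum_e[of "Suc m"] N[of "Suc m"] by (simp add: count m_def)
  have ge: "\<mu> \<le> w ! b" if "b < \<mu>" for b
    using that count[of "w ! b"] e_0[of "w ! b"] len by (metis count_list_0_iff not_less nth_mem)
  have hilbert: "card {b. b < \<mu> \<and> b \<le> i \<and> i < w ! b} = H i" for i
  proof -
    \<comment> \<open>Rows with \<open>w ! b <= i\<close> satisfy \<open>b <= i\<close>
      automatically, because \<open>b < mu <= w ! b\<close>.\<close>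
    have "card {b. b < \<mu> \<and> b \<le> i \<and> i < w ! b} + card {b. b < \<mu> \<and> w ! b \<le> i}
        = card {..<min \<mu> (Suc i)}"
      by (subst card_Un_disjoint[symmetric]) (use ge in \<open>force intro!: arg_cong[of _ _ card]\<close>)+
    then show ?thesis
      using card_nth_le[of w i] sum_e[of i] by (simp add: len count)
  qed
  have socle: "card {b. b < \<mu> \<and> w ! b = Suc i \<and> \<not> (Suc b < \<mu> \<and> w ! Suc b = Suc (Suc i))} = ST i" for i
  proof -
    \<comment> \<open>Of the \<open>e (i + 1)\<close> rows with letter \<open>i + 1\<close>, the
      ascents remove \<open>e (i + 1) - ST i\<close>.\<close>
    have "card {b. b < \<mu> \<and> w ! b = Suc i \<and> \<not> (Suc b < \<mu> \<and> w ! Suc b = Suc (Suc i))}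
        + card {b. Suc b < \<mu> \<and> w ! b = Suc i \<and> w ! Suc b = Suc (Suc i)}
        = card {b. b < \<mu> \<and> w ! b = Suc i}"
      by (subst card_Un_disjoint[symmetric])
         (auto intro!: arg_cong[of _ _ card] intro: finite_subset[of _ "{..<\<mu>}"])
    then show ?thesis
      using card_ascents[of w "Suc i"] card_nth_eq[of w "Suc i"] ST_le[of i]
      by (simp add: len count ascents r_def)
  qed
  have "\<exists>I :: 'k poly2 set. graded_ideal I \<and> artinian (quot I)
    \<and> has_hilbert_function I (\<lambda>i. card {b. b < \<mu> \<and> b \<le> i \<and> i < w ! b})
    \<and> has_socle_type I (\<lambda>i. card {b. b < \<mu> \<and> w ! b = Suc i \<and> \<not> (Suc b < \<mu> \<and> w ! Suc b = Suc (Suc i))})"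
  proof (rule monomial_ideal_of_staircase)
    show "0 < \<mu>" using H(1) by simp
    show "b < w ! b" if "b < \<mu>" for b
      using ge[OF that] that by simp
    show "w ! Suc b \<le> Suc (w ! b)" if "Suc b < \<mu>" for b
      using small_steps_nth[OF w(2)] that len by simp
  qed
  then show ?thesis
    unfolding hilbert socle .
qed

theorem theorem3p2:
  fixes H ST :: "nat \<Rightarrow> nat" and \<mu> :: nat
  assumes "\<mu> \<ge> 1"
    and "\<forall>i < \<mu>. H i = i + 1"
    and "H \<mu> \<le> \<mu>"
    and "\<forall>i \<ge> \<mu>. H (i + 1) \<le> H i"
    and "H \<longlonglongrightarrow> 0"
  shows "(\<exists>I :: 'k::field poly2 set.
            graded_ideal I \<and> artinian (quot I) \<and> has_hilbert_function I H \<and> has_socle_type I ST)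
         \<longleftrightarrow> (\<forall>i. first_diff \<mu> H (i + 1) - first_diff \<mu> H (i + 2) \<le> int (ST i)
                  \<and> int (ST i) \<le> first_diff \<mu> H (i + 1))"
    (is "?lhs \<longleftrightarrow> ?rhs")
proof
  assume ?lhs
  then obtain I :: "'k poly2 set" where I: "ideal I poly2_ring" "has_hilbert_function I H" "has_socle_type I ST"
    by (auto simp: graded_ideal_def)
  show ?rhs
    using socle_type_bounds[OF assms(1-4) I] by simp
qed (rule exists_monomial_ideal[OF assms])

end
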